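(* Let $\mathcal{H}$ be a Hilbert space and let $\mathfrak{K}(\mathcal{H})$ denote the ideal of compact operators in $B(\mathcal{H})$. Let $\mathcal{X}\subset B(\mathcal{H})$ be a subspace such that the weak-$*$ closure of $\mathcal{X}\cap\mathfrak{K}(\mathcal{H})$ in $B(\mathcal{H})$ contains $\mathcal{X}$. Then $\mathcal{X}$ and $B(\mathcal{H})$ admit compatible Lebesgue decompositions relative to $B(\mathcal{H})$. In particular, the inclusion $\mathcal{X}\subset B(\mathcal{H})$ has the Gleason--Whitney property relative to $B(\mathcal{H})$.
   Context: Write $\mathcal{W}=B(\mathcal{H})$. For a subspace $\mathcal{X}\subset\mathcal{W}$, a bounded linear functional on $\mathcal{X}$ is absolutely continuous (relative to $\mathcal{W}$) if it extends to a weak-$*$ continuous linear functional on $\mathcal{W}$; $\mathrm{AC}_{\mathcal{W}}(\mathcal{X})\subset\mathcal{X}^*$ is the space of these functionals. $\mathcal{X}$ admits a Lebesgue decomposition relative to $\mathcal{W}$ if there is a bounded linear idempotent $L:\mathcal{X}^*\to\mathcal{X}^*$ with $L\mathcal{X}^*=\mathrm{AC}_{\mathcal{W}}(\mathcal{X})$ and $\|\phi\|=\|L\phi\|+\|(I-L)\phi\|$ for all $\phi\in\mathcal{X}^*$. Then $\mathrm{SG}_{\mathcal{W}}(\mathcal{X}):=(I-L)\mathcal{X}^*$ is uniquely determined. If subspaces $\mathcal{X}\subset\mathcal{Y}$ both admit Lebesgue decompositions, these are compatible if for every $\psi=\psi_a+\psi_s\in\mathcal{Y}^*$ with $\psi_a\in\mathrm{AC}_{\mathcal{W}}(\mathcal{Y})$,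 $\psi_s\in\mathrm{SG}_{\mathcal{W}}(\mathcal{Y})$, one has $\psi_a|_{\mathcal{X}}\in\mathrm{AC}_{\mathcal{W}}(\mathcal{X})$ and $\psi_s|_{\mathcal{X}}\in\mathrm{SG}_{\mathcal{W}}(\mathcal{X})$. The inclusion $\mathcal{X}\subset\mathcal{Y}$ has the Gleason--Whitney property relative to $\mathcal{W}$ if whenever $\phi\in\mathrm{AC}_{\mathcal{W}}(\mathcal{X})$ and $\psi\in\mathcal{Y}^*$ satisfies $\psi|_{\mathcal{X}}=\phi$ and $\|\psi\|=\|\phi\|$, then $\psi\in\mathrm{AC}_{\mathcal{W}}(\mathcal{Y})$. *)

theory Defs
  imports "HOL-Analysis.Analysis"
begin

section \<open>Complex Hilbert spaces\<close>

text \<open>The inner product is linear in its first argument.  No separability or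
  dimension assumption is made.\<close>

class complex_hilbert_space = banach +
  fixes scaleC :: "complex \<Rightarrow> 'a \<Rightarrow> 'a"  (infixr \<open>*\<^sub>C\<close> 75)
    and cinner :: "'a \<Rightarrow> 'a \<Rightarrow> complex"
  assumes scaleC_add_right: "c *\<^sub>C (x + y) = c *\<^sub>C x + c *\<^sub>C y"
    and scaleC_add_left: "(c + d) *\<^sub>C x = c *\<^sub>C x + d *\<^sub>C x"
    and scaleC_scaleC: "c *\<^sub>C (d *\<^sub>C x) = (c * d) *\<^sub>C x"
    and scaleC_one: "1 *\<^sub>C x = x"
    and scaleR_scaleC: "r *\<^sub>R x = complex_of_real r *\<^sub>C x"
    and cinner_commute: "cinner x y = cnj (cinner y x)"
    and cinner_add_left: "cinner (x + y) z = cinner x z + cinner y z"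
    and cinner_scaleC_left: "cinner (c *\<^sub>C x) y = c * cinner x y"
    and cinner_same: "cinner x x = complex_of_real ((norm x)\<^sup>2)"

lemma norm_scaleC: "norm (c *\<^sub>C x) = cmod c * norm x"
  for x :: "'h::complex_hilbert_space"
proof -
  have "cinner (c *\<^sub>C x) (c *\<^sub>C x) = c * cnj (cinner (c *\<^sub>C x) x)"
    by (metis cinner_scaleC_left cinner_commute)
  also have "\<dots> = (c * cnj c) * cinner x x"
    by (simp add: cinner_scaleC_left cinner_same)
  finally have "complex_of_real ((norm (c *\<^sub>C x))\<^sup>2) = complex_of_real ((cmod c * norm x)\<^sup>2)"
    by (simp add: cinner_same complex_norm_square power_mult_distrib flip: of_real_power)
  then have "(norm (c *\<^sub>C x))\<^sup>2 = (cmod c * norm x)\<^sup>2"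
    by (simp only: of_real_eq_iff)
  then show ?thesis
    by (rule power2_eq_imp_eq) auto
qed

section \<open>The operators on a Hilbert space\<close>

text \<open>The library type of bounded linear maps only knows real linearity.  \<open>B(H)\<close> is the set
  of the complex-linear ones; its norm is the operator norm of the library type.\<close>

definition bounded_ops :: "('h::complex_hilbert_space \<Rightarrow>\<^sub>L 'h) set" where
  "bounded_ops = {T. \<forall>c x. blinfun_apply T (c *\<^sub>C x) = c *\<^sub>C blinfun_apply T x}"

definition compact_ops :: "('h::complex_hilbert_space \<Rightarrow>\<^sub>L 'h) set" where
  "compact_ops = {T \<in> bounded_ops. compact (closure (blinfun_apply T ` cball 0 1))}"

lift_definition op_scaleC ::
  "complex \<Rightarrow> ('h::complex_hilbert_space \<Rightarrow>\<^sub>L 'h) \<Rightarrow> ('h \<Rightarrow>\<^sub>L 'h)"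
  is "\<lambda>c T x. c *\<^sub>C T x"
proof -
  fix c :: complex and T :: "'h \<Rightarrow> 'h"
  assume T: "bounded_linear T"
  have "bounded_linear (\<lambda>x::'h. c *\<^sub>C x)"
    by (rule bounded_linear_intro[where K = "cmod c"])
      (simp_all add: scaleC_add_right scaleR_scaleC scaleC_scaleC norm_scaleC mult.commute)
  from bounded_linear_compose[OF this T] show "bounded_linear (\<lambda>x. c *\<^sub>C T x)" .
qed

definition op_subspace :: "('h::complex_hilbert_space \<Rightarrow>\<^sub>L 'h) set \<Rightarrow> bool" where
  "op_subspace X \<longleftrightarrow> X \<subseteq> bounded_ops \<and> 0 \<in> X \<and> (\<forall>S\<in>X. \<forall>T\<in>X. S + T \<in> X) \<and>
     (\<forall>c. \<forall>T\<in>X. op_scaleC c T \<in> X)"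

section \<open>The weak-* topology\<close>

text \<open>The predual of \<open>B(H)\<close> is the space of trace class operators \<open>S\<close>, acting by
  \<open>T \<mapsto> tr (T S)\<close>.  The trace class operators are exactly the operators
  \<open>S h = (\<Sum>n. \<langle>h, y\<^sub>n\<rangle> x\<^sub>n)\<close> with \<open>x\<close> and \<open>y\<close> square-summable, and then
  \<open>tr (T S) = (\<Sum>n. \<langle>T x\<^sub>n, y\<^sub>n\<rangle>)\<close>.\<close>

definition trace_functional ::
  "(nat \<Rightarrow> 'h::complex_hilbert_space) \<Rightarrow> (nat \<Rightarrow> 'h) \<Rightarrow> ('h \<Rightarrow>\<^sub>L 'h) \<Rightarrow> complex" where
  "trace_functional x y T = (\<Sum>n. cinner (blinfun_apply T (x n)) (y n))"

definition predual :: "(('h::complex_hilbert_space \<Rightarrow>\<^sub>L 'h) \<Rightarrow> complex) set" where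
  "predual = {trace_functional x y | x y.
     summable (\<lambda>n. (norm (x n))\<^sup>2) \<and> summable (\<lambda>n. (norm (y n))\<^sup>2)}"

definition weak_star_topology :: "('h::complex_hilbert_space \<Rightarrow>\<^sub>L 'h) topology" where
  "weak_star_topology =
     topology_generated_by {{T \<in> bounded_ops. f T \<in> U} | f U. f \<in> predual \<and> open U}"

lemma topspace_weak_star_topology: "topspace weak_star_topology = bounded_ops"
proof -
  have "trace_functional (\<lambda>_. 0) (\<lambda>_. 0) \<in> (predual :: (('a \<Rightarrow>\<^sub>L 'a) \<Rightarrow> complex) set)"
    unfolding predual_def by (intro CollectI exI[of _ "\<lambda>_. 0"] conjI refl) simp_all
  then have "\<exists>f U. (bounded_ops :: ('a \<Rightarrow>\<^sub>L 'a) set) = {T \<in> bounded_ops. f T \<in> U} \<and>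
      f \<in> predual \<and> open U"
    by (intro exI[of _ "trace_functional (\<lambda>_. 0) (\<lambda>_. 0)"] exI[of _ UNIV]) simp
  then show ?thesis
    unfolding weak_star_topology_def by auto
qed

section \<open>Functionals on subspaces of \<open>B(H)\<close>\<close>

text \<open>A functional on \<open>X\<close> is represented by a function that vanishes outside \<open>X\<close>, so that
  functionals on \<open>X\<close> are equal iff the representing functions are.\<close>

type_synonym 'h op_functional = "('h \<Rightarrow>\<^sub>L 'h) \<Rightarrow> complex"

definition linear_functional ::
  "('h::complex_hilbert_space \<Rightarrow>\<^sub>L 'h) set \<Rightarrow> 'h op_functional \<Rightarrow> bool" where
  "linear_functional X \<phi> \<longleftrightarrow> (\<forall>T. T \<notin> X \<longrightarrow> \<phi> T = 0) \<and>
     (\<forall>S\<in>X. \<forall>T\<in>X. \<phi> (S + T) = \<phi> S + \<phi> T) \<and>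
     (\<forall>c. \<forall>T\<in>X. \<phi> (op_scaleC c T) = c * \<phi> T)"

definition dual :: "('h::complex_hilbert_space \<Rightarrow>\<^sub>L 'h) set \<Rightarrow> 'h op_functional set" where
  "dual X = {\<phi>. linear_functional X \<phi> \<and> (\<exists>K. \<forall>T\<in>X. cmod (\<phi> T) \<le> K * norm T)}"

definition dual_norm ::
  "('h::complex_hilbert_space \<Rightarrow>\<^sub>L 'h) set \<Rightarrow> 'h op_functional \<Rightarrow> real" where
  "dual_norm X \<phi> = (SUP T\<in>{T \<in> X. norm T \<le> 1}. cmod (\<phi> T))"

definition restrict_functional ::
  "('h::complex_hilbert_space \<Rightarrow>\<^sub>L 'h) set \<Rightarrow> 'h op_functional \<Rightarrow> 'h op_functional" where
  "restrict_functional X \<psi> = (\<lambda>T. if T \<in> X then \<psi> T else 0)"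

section \<open>Lebesgue decompositions\<close>

text \<open>All notions below are relative to \<open>B(H)\<close>.\<close>

definition AC :: "('h::complex_hilbert_space \<Rightarrow>\<^sub>L 'h) set \<Rightarrow> 'h op_functional set" where
  "AC X = {\<phi> \<in> dual X. \<exists>\<psi>. linear_functional bounded_ops \<psi> \<and>
     continuous_map weak_star_topology euclidean \<psi> \<and> restrict_functional X \<psi> = \<phi>}"

text \<open>The bounded linear idempotents \<open>L\<close> on the dual of \<open>X\<close> that witness a
  Lebesgue decomposition; the values of \<open>L\<close> outside the dual are irrelevant.\<close>

definition lebesgue_projection ::
  "('h::complex_hilbert_space \<Rightarrow>\<^sub>L 'h) set \<Rightarrow> ('h op_functional \<Rightarrow> 'h op_functional) \<Rightarrow> bool" where
  "lebesgue_projection X L \<longleftrightarrow>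
     (\<forall>\<phi>\<in>dual X. L \<phi> \<in> dual X) \<and>
     (\<forall>\<phi>\<in>dual X. \<forall>\<psi>\<in>dual X. L (\<lambda>T. \<phi> T + \<psi> T) = (\<lambda>T. L \<phi> T + L \<psi> T)) \<and>
     (\<forall>c. \<forall>\<phi>\<in>dual X. L (\<lambda>T. c * \<phi> T) = (\<lambda>T. c * L \<phi> T)) \<and>
     (\<exists>K. \<forall>\<phi>\<in>dual X. dual_norm X (L \<phi>) \<le> K * dual_norm X \<phi>) \<and>
     (\<forall>\<phi>\<in>dual X. L (L \<phi>) = L \<phi>) \<and>
     L ` dual X = AC X \<and>
     (\<forall>\<phi>\<in>dual X. dual_norm X \<phi> = dual_norm X (L \<phi>) + dual_norm X (\<lambda>T. \<phi> T - L \<phi> T))"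

definition admits_lebesgue_decomposition ::
  "('h::complex_hilbert_space \<Rightarrow>\<^sub>L 'h) set \<Rightarrow> bool" where
  "admits_lebesgue_decomposition X \<longleftrightarrow> (\<exists>L. lebesgue_projection X L)"

text \<open>The range of \<open>I - L\<close> does not depend on the choice of \<open>L\<close>; see \<open>SG_eq\<close> below.\<close>

definition SG :: "('h::complex_hilbert_space \<Rightarrow>\<^sub>L 'h) set \<Rightarrow> 'h op_functional set" where
  "SG X = {\<lambda>T. \<phi> T - L \<phi> T | L \<phi>. lebesgue_projection X L \<and> \<phi> \<in> dual X}"

definition compatible_lebesgue_decompositions ::
  "('h::complex_hilbert_space \<Rightarrow>\<^sub>L 'h) set \<Rightarrow> ('h \<Rightarrow>\<^sub>L 'h) set \<Rightarrow> bool" where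
  "compatible_lebesgue_decompositions X Y \<longleftrightarrow>
     X \<subseteq> Y \<and> admits_lebesgue_decomposition X \<and> admits_lebesgue_decomposition Y \<and>
     (\<forall>\<psi>\<in>dual Y. \<forall>\<psi>\<^sub>a\<in>AC Y. \<forall>\<psi>\<^sub>s\<in>SG Y. \<psi> = (\<lambda>T. \<psi>\<^sub>a T + \<psi>\<^sub>s T) \<longrightarrow>
        restrict_functional X \<psi>\<^sub>a \<in> AC X \<and> restrict_functional X \<psi>\<^sub>s \<in> SG X)"

definition gleason_whitney_property ::
  "('h::complex_hilbert_space \<Rightarrow>\<^sub>L 'h) set \<Rightarrow> ('h \<Rightarrow>\<^sub>L 'h) set \<Rightarrow> bool" where
  "gleason_whitney_property X Y \<longleftrightarrow>
     (\<forall>\<phi>\<in>AC X. \<forall>\<psi>\<in>dual Y.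
        restrict_functional X \<psi> = \<phi> \<and> dual_norm Y \<psi> = dual_norm X \<phi> \<longrightarrow> \<psi> \<in> AC Y)"

lemma dual_diff:
  assumes "op_subspace X" "\<phi> \<in> dual X" "\<psi> \<in> dual X"
  shows "(\<lambda>T. \<phi> T - \<psi> T) \<in> dual X"
proof -
  obtain K M where "\<forall>T\<in>X. cmod (\<phi> T) \<le> K * norm T" "\<forall>T\<in>X. cmod (\<psi> T) \<le> M * norm T"
    using assms by (auto simp: dual_def)
  then have "\<forall>T\<in>X. cmod (\<phi> T - \<psi> T) \<le> (K + M) * norm T"
    by (auto simp: distrib_right intro: order_trans[OF norm_triangle_ineq4 add_mono])
  then have "\<exists>K. \<forall>T\<in>X. cmod (\<phi> T - \<psi> T) \<le> K * norm T"
    by blast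
  moreover have "linear_functional X (\<lambda>T. \<phi> T - \<psi> T)"
    using assms by (auto simp: dual_def linear_functional_def algebra_simps)
  ultimately show ?thesis
    by (simp add: dual_def)
qed

lemma dual_norm_eq_0_imp:
  assumes X: "op_subspace X" and \<phi>: "\<phi> \<in> dual X" and 0: "dual_norm X \<phi> = 0"
  shows "\<phi> T = 0"
proof (cases "T \<in> X \<and> T \<noteq> 0")
  case True
  obtain K where K: "\<forall>T\<in>X. cmod (\<phi> T) \<le> K * norm T"
    using \<phi> by (auto simp: dual_def)
  have K': "cmod (\<phi> S) \<le> \<bar>K\<bar>" if "S \<in> X" "norm S \<le> 1" for S
  proof -
    have "K * norm S \<le> \<bar>K\<bar> * norm S" by (simp add: mult_right_mono)
    also have "\<dots> \<le> \<bar>K\<bar> * 1" using that by (intro mult_left_mono) auto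
    finally show ?thesis using K that by fastforce
  qed
  define c where "c = complex_of_real (inverse (norm T))"
  have scale: "op_scaleC c T = inverse (norm T) *\<^sub>R T"
    unfolding c_def by transfer (simp add: scaleR_scaleC)
  have "op_scaleC c T \<in> X"
    using X True by (simp add: op_subspace_def)
  moreover have "norm (op_scaleC c T) \<le> 1"
    using True scale by simp
  ultimately have "cmod (\<phi> (op_scaleC c T)) \<le> dual_norm X \<phi>"
    unfolding dual_norm_def by (intro cSUP_upper bdd_aboveI2[where M = "\<bar>K\<bar>"]) (auto intro: K')
  then show ?thesis
    using True \<phi> 0 by (auto simp: dual_def linear_functional_def c_def)
next
  case False
  have "op_scaleC 0 0 = (0 :: 'a \<Rightarrow>\<^sub>L 'a)"
    by transfer (metis mult_zero_left norm_eq_zero norm_scaleC norm_zero)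
  then have "\<phi> 0 = 0"
    using X \<phi> unfolding op_subspace_def dual_def linear_functional_def
    by (metis (mono_tags, lifting) mem_Collect_eq mult_zero_left)
  then show ?thesis
    using False \<phi> by (auto simp: dual_def linear_functional_def)
qed

lemma lebesgue_projection_unique:
  assumes X: "op_subspace X" and P: "lebesgue_projection X P" and Q: "lebesgue_projection X Q"
    and \<phi>: "\<phi> \<in> dual X"
  shows "P \<phi> = Q \<phi>"
proof -
  have add: "R (\<lambda>T. \<alpha> T - \<beta> T) = (\<lambda>T. R \<alpha> T - R \<beta> T)"
    if R: "lebesgue_projection X R" and "\<alpha> \<in> dual X" "\<beta> \<in> dual X" for R \<alpha> \<beta>
  proof -
    have d: "(\<lambda>T. \<alpha> T - \<beta> T) \<in> dual X" using dual_diff[OF X] that by auto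
    have "R (\<lambda>T. (\<alpha> T - \<beta> T) + \<beta> T) = (\<lambda>T. R (\<lambda>T. \<alpha> T - \<beta> T) T + R \<beta> T)"
      using R[unfolded lebesgue_projection_def, THEN conjunct2, THEN conjunct1,
          THEN bspec, OF d, THEN bspec, OF that(3)] .
    then have "R \<alpha> = (\<lambda>T. R (\<lambda>T. \<alpha> T - \<beta> T) T + R \<beta> T)" by simp
    then show ?thesis by (metis (no_types, lifting) ext add_diff_cancel_right')
  qed
  have fix_AC: "R \<alpha> = \<alpha>" if "lebesgue_projection X R" "\<alpha> \<in> AC X" for R \<alpha>
    using that unfolding lebesgue_projection_def by (metis (no_types, lifting) imageE)
  have AC_dual: "\<alpha> \<in> dual X" if "\<alpha> \<in> AC X" for \<alpha> using that by (simp add: AC_def)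
  have in_AC: "R \<alpha> \<in> AC X" if "lebesgue_projection X R" "\<alpha> \<in> dual X" for R \<alpha>
    using that unfolding lebesgue_projection_def by blast
  have norm_eq: "dual_norm X \<alpha> = dual_norm X (R \<alpha>) + dual_norm X (\<lambda>T. \<alpha> T - R \<alpha> T)"
    if "lebesgue_projection X R" "\<alpha> \<in> dual X" for R \<alpha>
    using that unfolding lebesgue_projection_def by blast
  define s where "s = (\<lambda>T. \<phi> T - P \<phi> T)"
  have Pd: "P \<phi> \<in> dual X" using in_AC[OF P \<phi>] AC_dual by blast
  have s: "s \<in> dual X" unfolding s_def using dual_diff[OF X \<phi> Pd] .
  have Ps: "P s = (\<lambda>_. 0)"
    unfolding s_def using add[OF P \<phi> Pd] fix_AC[OF P in_AC[OF P \<phi>]] by simp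
  define q where "q = Q s"
  have q: "q \<in> AC X" "q \<in> dual X" unfolding q_def using in_AC[OF Q s] AC_dual by auto
  define r where "r = (\<lambda>T. s T - q T)"
  have r: "r \<in> dual X" unfolding r_def using dual_diff[OF X s q(2)] .
  have Pr: "P r = (\<lambda>T. - q T)"
    unfolding r_def using add[OF P s q(2)] Ps fix_AC[OF P q(1)] by simp
  have neg: "dual_norm X (\<lambda>T. - q T) = dual_norm X q" by (simp add: dual_norm_def)
  have "dual_norm X r = dual_norm X q + dual_norm X s"
    using norm_eq[OF P r] unfolding Pr neg by (simp add: r_def)
  moreover have "dual_norm X s = dual_norm X q + dual_norm X r"
    using norm_eq[OF Q s] by (simp add: r_def q_def)
  ultimately have "dual_norm X q = 0" by simp
  then have "q T = 0" for T using dual_norm_eq_0_imp[OF X q(2)] by blast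
  moreover have "q = (\<lambda>T. Q \<phi> T - P \<phi> T)"
    unfolding q_def s_def using add[OF Q \<phi> Pd] fix_AC[OF Q in_AC[OF P \<phi>]] by simp
  ultimately show ?thesis by (metis (no_types, lifting) ext right_minus_eq)
qed

lemma SG_eq:
  assumes "op_subspace X" "lebesgue_projection X L"
  shows "SG X = (\<lambda>\<phi> T. \<phi> T - L \<phi> T) ` dual X"
proof -
  have "(\<lambda>T. \<phi> T - M \<phi> T) = (\<lambda>T. \<phi> T - L \<phi> T)"
    if "lebesgue_projection X M" "\<phi> \<in> dual X" for M \<phi>
    using lebesgue_projection_unique[OF assms(1) that(1) assms(2) that(2)] by simp
  then show ?thesis
    using assms(2) unfolding SG_def image_def by blast
qed

end

theory Submission
  imports Defs
begin

text \<open>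
  Let \<open>K\<close> be the compact operators.  A weak-* continuous functional on \<open>X\<close> is determined by its
  values on \<open>X \<inter> K\<close>, because \<open>X \<inter> K\<close> is weak-* dense in \<open>X\<close>.  The Lebesgue decomposition of
  \<open>\<phi> \<in> X\<^sup>*\<close> is therefore forced: its absolutely continuous part is the weak-* continuous functional that
  agrees with \<open>\<phi>\<close> on \<open>X \<inter> K\<close>, and the singular functionals are those that vanish on \<open>X \<inter> K\<close>.
  Uniqueness makes the projection linear and idempotent; what has to be proved is that the
  absolutely continuous part exists and that the norm is additive.

  Both reduce to \<open>B(H)\<close>.  Extend \<open>\<phi>\<close> to \<open>\<psi>\<close> on \<open>B(H)\<close> with the same norm (Hahn--Banach), write
  \<open>\<psi> = \<alpha> + \<sigma>\<close> with \<open>\<alpha>\<close> weak-* continuous, \<open>\<sigma> = 0\<close> on \<open>K\<close> and \<open>\<parallel>\<alpha>\<parallel> + \<parallel>\<sigma>\<parallel> \<le> \<parallel>\<psi>\<parallel>\<close>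
  (\<open>functional_split\<close>), and restrict to \<open>X\<close>; restriction does not increase norms, so
  \<open>\<parallel>\<alpha>|\<^bsub>X\<^esub>\<parallel> + \<parallel>\<sigma>|\<^bsub>X\<^esub>\<parallel> \<le> \<parallel>\<phi>\<parallel>\<close>, and the triangle inequality gives equality
  (\<open>decomposition_exists\<close>).

  The splitting on \<open>B(H)\<close> is the duality between compact and trace class operators.  The numbers
  \<open>\<psi>(x \<otimes> y\<^sup>*)\<close> form a bounded sesquilinear form, hence come from an operator \<open>S\<close>.  Pairing \<open>\<psi>\<close> with the
  contractions \<open>\<Sum> e\<^sub>i \<otimes> f\<^sub>i\<^sup>*\<close> bounds \<open>\<Sum> \<langle>S e\<^sub>i, f\<^sub>i\<rangle>\<close> by \<open>\<parallel>\<psi>\<parallel>\<close> for all orthonormal families,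
  so \<open>S\<close> is compact, and its singular values, obtained by repeatedly splitting off a vector at which
  the norm is attained, are summable.  The resulting series \<open>\<alpha>\<close> in the predual agrees with \<open>\<psi>\<close> on the
  rank-one operators and so on \<open>K\<close> (\<open>functional_trace_on_rank_one\<close>, \<open>vanishes_on_compact_ops\<close>).

  The norm is additive because \<open>\<alpha>\<close> and \<open>\<sigma>\<close> live on different corners.  For a finite-rank projection
  \<open>P\<close>, the operator \<open>P S P + (1 - P) T (1 - P)\<close> is a contraction whenever \<open>S\<close> and \<open>T\<close> are; \<open>\<sigma>\<close> sees
  only \<open>T\<close>, since the operator differs from \<open>T\<close> by a compact one, whereas along the net of finite-rank
  projections \<open>\<alpha>\<close> sees only \<open>S\<close>.  The same net shows that \<open>K\<close> is weak-* dense in \<open>B(H)\<close>, so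
  \<open>B(H)\<close> is itself an instance of the construction, and the two decompositions are compatible because
  functionals vanishing on \<open>K\<close> restrict to functionals vanishing on \<open>X \<inter> K\<close>.

  For the Gleason--Whitney property, let \<open>\<psi> = \<alpha> + \<sigma>\<close> extend an absolutely continuous \<open>\<phi>\<close> with the
  same norm.  Then \<open>\<alpha>\<close> and \<open>\<phi>\<close> agree on \<open>X \<inter> K\<close>, so \<open>\<alpha>\<close> already extends \<open>\<phi>\<close> and
  \<open>\<parallel>\<alpha>\<parallel> \<ge> \<parallel>\<phi>\<parallel> = \<parallel>\<psi>\<parallel> = \<parallel>\<alpha>\<parallel> + \<parallel>\<sigma>\<parallel>\<close> forces \<open>\<sigma> = 0\<close>.
\<close>

section \<open>Inner products, projections and Riesz representation\<close>

lemma cinner_add_right: "cinner x (y + z) = cinner x y + cinner x z"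
  for x :: "'h::complex_hilbert_space"
  by (metis cinner_add_left cinner_commute complex_cnj_add)

lemma cinner_scaleC_right: "cinner x (c *\<^sub>C y) = cnj c * cinner x y"
  for x :: "'h::complex_hilbert_space"
  by (metis cinner_commute cinner_scaleC_left complex_cnj_mult)

lemma cinner_zero_left [simp]: "cinner 0 (y::'h::complex_hilbert_space) = 0"
  by (metis add_cancel_right_right cinner_add_left)

lemma cinner_zero_right [simp]: "cinner (x::'h::complex_hilbert_space) 0 = 0"
  by (metis add_cancel_right_right cinner_add_right)

lemma cinner_minus_left: "cinner (- x) y = - cinner x y"
  for x :: "'h::complex_hilbert_space"
  by (metis ab_group_add_class.ab_left_minus cinner_add_left cinner_zero_left minus_unique
      add.commute)

lemma cinner_minus_right: "cinner x (- y) = - cinner x y"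
  for x :: "'h::complex_hilbert_space"
  by (metis cinner_minus_left cinner_commute complex_cnj_minus)

lemma cinner_diff_left: "cinner (x - y) z = cinner x z - cinner y z"
  for x :: "'h::complex_hilbert_space"
  by (metis cinner_add_left cinner_minus_left diff_conv_add_uminus)

lemma cinner_diff_right: "cinner x (y - z) = cinner x y - cinner x z"
  for x :: "'h::complex_hilbert_space"
  by (metis cinner_add_right cinner_minus_right diff_conv_add_uminus)

lemma cinner_sum_left: "cinner (\<Sum>i\<in>I. f i) y = (\<Sum>i\<in>I. cinner (f i) y)"
  for f :: "'i \<Rightarrow> 'h::complex_hilbert_space"
  by (induction I rule: infinite_finite_induct) (auto simp: cinner_add_left)

lemma cinner_sum_right: "cinner x (\<Sum>i\<in>I. f i) = (\<Sum>i\<in>I. cinner x (f i))"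
  for f :: "'i \<Rightarrow> 'h::complex_hilbert_space"
  by (induction I rule: infinite_finite_induct) (auto simp: cinner_add_right)

lemma cinner_scaleR_left: "cinner (r *\<^sub>R x) y = r * cinner x y"
  for x :: "'h::complex_hilbert_space"
  by (simp add: scaleR_scaleC cinner_scaleC_left)

lemma cinner_scaleR_right: "cinner x (r *\<^sub>R y) = r * cinner x y"
  for x :: "'h::complex_hilbert_space"
  by (simp add: scaleR_scaleC cinner_scaleC_right)

lemma cinner_eq_0_commute: "cinner x y = 0 \<longleftrightarrow> cinner y x = 0"
  for x :: "'h::complex_hilbert_space"
  by (metis cinner_commute complex_cnj_zero)

lemmas cinner_simps = cinner_add_left cinner_add_right cinner_diff_left cinner_diff_right
  cinner_minus_left cinner_minus_right cinner_scaleC_left cinner_scaleC_right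
  cinner_scaleR_left cinner_scaleR_right

lemma scaleC_zero_left [simp]: "0 *\<^sub>C (x::'h::complex_hilbert_space) = 0"
  by (metis add_cancel_right_right scaleC_add_left)

lemma scaleC_zero_right [simp]: "c *\<^sub>C (0::'h::complex_hilbert_space) = 0"
  by (metis add_cancel_right_right scaleC_add_right)

lemma scaleC_diff_right: "c *\<^sub>C (x - y) = c *\<^sub>C x - c *\<^sub>C y"
  for x :: "'h::complex_hilbert_space"
  by (metis add_diff_cancel diff_add_cancel scaleC_add_right)

lemma scaleC_scaleR_commute: "c *\<^sub>C (r *\<^sub>R x) = r *\<^sub>R (c *\<^sub>C x)"
  for x :: "'h::complex_hilbert_space"
  by (simp add: scaleR_scaleC scaleC_scaleC mult.commute)

lemma norm_add_sq: "(norm (x + y))\<^sup>2 = (norm x)\<^sup>2 + 2 * Re (cinner x y) + (norm y)\<^sup>2"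
  for x :: "'h::complex_hilbert_space"
proof -
  have "complex_of_real ((norm (x + y))\<^sup>2)
      = complex_of_real ((norm x)\<^sup>2) + (cinner x y + cnj (cinner x y)) + complex_of_real ((norm y)\<^sup>2)"
    by (simp add: cinner_same [symmetric] cinner_simps cinner_commute [of x y] algebra_simps
        del: of_real_power)
  then have "Re (complex_of_real ((norm (x + y))\<^sup>2))
      = Re (complex_of_real ((norm x)\<^sup>2) + (cinner x y + cnj (cinner x y)) + complex_of_real ((norm y)\<^sup>2))"
    by simp
  then show ?thesis by simp
qed

lemma norm_diff_sq: "(norm (x - y))\<^sup>2 = (norm x)\<^sup>2 - 2 * Re (cinner x y) + (norm y)\<^sup>2"
  for x :: "'h::complex_hilbert_space"
  using norm_add_sq [of x "- y"] by (simp add: cinner_simps)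

lemma parallelogram:
  "(norm (x + y))\<^sup>2 + (norm (x - y))\<^sup>2 = 2 * (norm x)\<^sup>2 + 2 * (norm y)\<^sup>2"
  for x :: "'h::complex_hilbert_space"
  by (simp add: norm_add_sq norm_diff_sq)

lemma pythagoras: "cinner x y = 0 \<Longrightarrow> (norm (x + y))\<^sup>2 = (norm x)\<^sup>2 + (norm y)\<^sup>2"
  for x :: "'h::complex_hilbert_space"
  by (simp add: norm_add_sq)

lemma phase_exists: "\<exists>c. cmod c = 1 \<and> c * z = complex_of_real (cmod z)"
proof (cases "z = 0")
  case False
  then show ?thesis
    by (intro exI[of _ "cnj z / complex_of_real (cmod z)"])
      (simp add: norm_divide complex_norm_square [symmetric] power2_eq_square field_simps
        flip: complex_norm_square)
qed (auto intro: exI[of _ 1])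

lemma cinner_Cauchy_Schwarz: "cmod (cinner x y) \<le> norm x * norm y"
  for x :: "'h::complex_hilbert_space"
proof -
  have unit: "cmod (cinner x y) \<le> 1" if "norm x = 1" "norm y = 1" for x y :: 'h
  proof -
    obtain c where c: "cmod c = 1" "c * cinner x y = complex_of_real (cmod (cinner x y))"
      using phase_exists by blast
    have "0 \<le> (norm (c *\<^sub>C x - y))\<^sup>2" by simp
    also have "\<dots> = 2 - 2 * cmod (cinner x y)"
      using that c by (simp add: norm_diff_sq cinner_scaleC_left norm_scaleC)
    finally show ?thesis by simp
  qed
  show ?thesis
  proof (cases "x = 0 \<or> y = 0")
    case False
    have "cmod (cinner (x /\<^sub>R norm x) (y /\<^sub>R norm y)) \<le> 1"
      using False by (intro unit) auto
    then show ?thesis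
      using False by (simp add: cinner_simps norm_mult norm_divide divide_simps mult.commute)
  qed auto
qed

lemma cinner_eqI: "(\<And>z. cinner x z = cinner y z) \<Longrightarrow> x = y"
  for x :: "'h::complex_hilbert_space"
  by (metis cinner_diff_left cinner_same diff_self eq_iff_diff_eq_0 of_real_eq_0_iff
      power2_eq_square mult_eq_0_iff norm_eq_zero)

text \<open>Orthogonal families whose members may be shorter than unit vectors; zero members let a
  sequence stop early.\<close>

definition subnormal_family :: "'i set \<Rightarrow> ('i \<Rightarrow> 'h::complex_hilbert_space) \<Rightarrow> bool" where
  "subnormal_family I e \<longleftrightarrow>
     (\<forall>i\<in>I. norm (e i) \<le> 1) \<and> (\<forall>i\<in>I. \<forall>j\<in>I. i \<noteq> j \<longrightarrow> cinner (e i) (e j) = 0)"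

lemma norm_sum_orthogonal:
  fixes v :: "'i \<Rightarrow> 'h::complex_hilbert_space"
  assumes "finite I" "\<And>i j. i \<in> I \<Longrightarrow> j \<in> I \<Longrightarrow> i \<noteq> j \<Longrightarrow> cinner (v i) (v j) = 0"
  shows "(norm (\<Sum>i\<in>I. v i))\<^sup>2 = (\<Sum>i\<in>I. (norm (v i))\<^sup>2)"
  using assms
proof (induction I rule: finite_induct)
  case (insert i I)
  have "cinner (v i) (\<Sum>j\<in>I. v j) = 0"
    unfolding cinner_sum_right using insert by (intro sum.neutral) auto
  then show ?case using insert by (simp add: pythagoras)
qed simp

text \<open>Expand \<open>0 \<le> \<parallel>h - p\<parallel>\<^sup>2\<close> for \<open>p = \<Sum> \<langle>h, e\<^sub>i\<rangle> e\<^sub>i\<close>; members of norm less than 1 only make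
  \<open>\<parallel>p\<parallel>\<close> smaller than in the orthonormal case.\<close>

lemma Bessel:
  fixes e :: "'i \<Rightarrow> 'h::complex_hilbert_space"
  assumes "finite I" "subnormal_family I e"
  shows "(\<Sum>i\<in>I. (cmod (cinner h (e i)))\<^sup>2) \<le> (norm h)\<^sup>2"
proof -
  define p where "p = (\<Sum>i\<in>I. cinner h (e i) *\<^sub>C e i)"
  let ?s = "\<Sum>i\<in>I. (cmod (cinner h (e i)))\<^sup>2"
  have "(norm p)\<^sup>2 = (\<Sum>i\<in>I. (norm (cinner h (e i) *\<^sub>C e i))\<^sup>2)"
    unfolding p_def using assms
    by (intro norm_sum_orthogonal) (auto simp: subnormal_family_def cinner_simps)
  also have "\<dots> \<le> ?s"
    using assms(2) unfolding subnormal_family_def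
    by (intro sum_mono) (auto simp: norm_scaleC power_mult_distrib intro!: mult_left_le power_le_one)
  finally have p: "(norm p)\<^sup>2 \<le> ?s" .
  have "cinner h p = complex_of_real ?s"
    unfolding p_def cinner_sum_right of_real_sum
    by (intro sum.cong refl) (simp only: cinner_scaleC_right complex_norm_square mult.commute)
  then have "Re (cinner h p) = ?s" by (simp only: Re_complex_of_real)
  moreover have "0 \<le> (norm (h - p))\<^sup>2" by simp
  ultimately show ?thesis using p unfolding norm_diff_sq by linarith
qed

lemma norm_sum_subnormal_le:
  fixes e :: "'i \<Rightarrow> 'h::complex_hilbert_space"
  assumes "finite I" "subnormal_family I e"
  shows "(norm (\<Sum>i\<in>I. c i *\<^sub>C e i))\<^sup>2 \<le> (\<Sum>i\<in>I. (cmod (c i))\<^sup>2)"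
proof -
  have "(norm (\<Sum>i\<in>I. c i *\<^sub>C e i))\<^sup>2 = (\<Sum>i\<in>I. (norm (c i *\<^sub>C e i))\<^sup>2)"
    using assms
    by (intro norm_sum_orthogonal) (auto simp: subnormal_family_def cinner_simps)
  also have "\<dots> \<le> (\<Sum>i\<in>I. (cmod (c i))\<^sup>2)"
    using assms(2) unfolding subnormal_family_def
    by (intro sum_mono) (auto simp: norm_scaleC power_mult_distrib intro!: mult_left_le power_le_one)
  finally show ?thesis .
qed

subsection \<open>Rank-one operators and finite-rank projections\<close>

lift_definition rank_one :: "'h::complex_hilbert_space \<Rightarrow> 'h \<Rightarrow> ('h \<Rightarrow>\<^sub>L 'h)"
  is "\<lambda>x y h. cinner h y *\<^sub>C x"
proof -
  fix x y :: 'h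
  show "bounded_linear (\<lambda>h. cinner h y *\<^sub>C x)"
    by (rule bounded_linear_intro[where K = "norm x * norm y"])
      (auto simp: cinner_simps scaleC_add_left scaleR_scaleC scaleC_scaleC norm_scaleC
        intro: order_trans[OF mult_right_mono[OF cinner_Cauchy_Schwarz norm_ge_zero]])
qed

lemma rank_one_apply [simp]: "blinfun_apply (rank_one x y) h = cinner h y *\<^sub>C x"
  by (simp add: rank_one.rep_eq)

lemma norm_rank_one_le: "norm (rank_one x y) \<le> norm x * norm y"
proof (rule norm_blinfun_bound)
  fix h
  have "cmod (cinner h y) * norm x \<le> (norm h * norm y) * norm x"
    by (intro mult_right_mono cinner_Cauchy_Schwarz) auto
  then show "norm (blinfun_apply (rank_one x y) h) \<le> norm x * norm y * norm h"
    by (simp add: norm_scaleC mult.commute mult.left_commute)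
qed simp

lemma op_scaleC_apply [simp]: "blinfun_apply (op_scaleC c T) h = c *\<^sub>C blinfun_apply T h"
  by (simp add: op_scaleC.rep_eq)

definition orthonormal :: "'h::complex_hilbert_space set \<Rightarrow> bool" where
  "orthonormal E \<longleftrightarrow> finite E \<and> (\<forall>e\<in>E. \<forall>f\<in>E. cinner e f = (if e = f then 1 else 0))"

definition proj :: "'h::complex_hilbert_space set \<Rightarrow> 'h \<Rightarrow>\<^sub>L 'h" where
  "proj E = (\<Sum>e\<in>E. rank_one e e)"

lemma proj_apply: "blinfun_apply (proj E) h = (\<Sum>e\<in>E. cinner h e *\<^sub>C e)"
  by (simp add: proj_def blinfun.sum_left)

lemma orthonormal_cinner_proj:
  assumes "orthonormal E" "e \<in> E"
  shows "cinner (blinfun_apply (proj E) h) e = cinner h e"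
proof -
  have "cinner (blinfun_apply (proj E) h) e = (\<Sum>f\<in>E. if f = e then cinner h f else 0)"
    unfolding proj_apply cinner_sum_left using assms
    by (intro sum.cong refl) (auto simp: orthonormal_def cinner_simps)
  then show ?thesis using assms by (simp add: orthonormal_def)
qed

lemma proj_idem:
  assumes "orthonormal E"
  shows "blinfun_apply (proj E) (blinfun_apply (proj E) h) = blinfun_apply (proj E) h"
proof -
  have "blinfun_apply (proj E) (blinfun_apply (proj E) h) = (\<Sum>e\<in>E. cinner h e *\<^sub>C e)"
    unfolding proj_apply [of E "blinfun_apply (proj E) h"]
    by (intro sum.cong refl) (simp only: orthonormal_cinner_proj[OF assms])
  then show ?thesis by (simp only: proj_apply)
qed

lemma cinner_proj_left:
  "cinner (blinfun_apply (proj E) h) k = cinner h (blinfun_apply (proj E) k)"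
  unfolding proj_apply cinner_sum_left cinner_sum_right cinner_simps
  by (intro sum.cong refl) (metis cinner_commute mult.commute)

lemma proj_orth:
  assumes "orthonormal E"
  shows "cinner (blinfun_apply (proj E) h) (k - blinfun_apply (proj E) k) = 0"
  by (simp add: cinner_proj_left blinfun.diff_right proj_idem[OF assms])

lemma proj_pythagoras:
  assumes "orthonormal E"
  shows "(norm h)\<^sup>2 = (norm (blinfun_apply (proj E) h))\<^sup>2
    + (norm (h - blinfun_apply (proj E) h))\<^sup>2"
  using pythagoras[OF proj_orth[OF assms, of h h]] by simp

lemma norm_proj_apply_le:
  assumes "orthonormal E"
  shows "norm (blinfun_apply (proj E) h) \<le> norm h"
    and "norm (h - blinfun_apply (proj E) h) \<le> norm h"
  using proj_pythagoras[OF assms, of h] by (auto intro: power2_le_imp_le)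

text \<open>One Gram--Schmidt step per vector.  Finite-rank projections that fix prescribed vectors form the
  net along which everything below converges.\<close>

lemma proj_fixing_finite_set:
  assumes "finite F"
  shows "\<exists>E. orthonormal E \<and> (\<forall>x\<in>F. blinfun_apply (proj E) x = x)"
  using assms
proof (induction F rule: finite_induct)
  case empty
  then show ?case by (intro exI[of _ "{}"]) (auto simp: orthonormal_def)
next
  case (insert x F)
  then obtain E where E: "orthonormal E" "\<forall>x\<in>F. blinfun_apply (proj E) x = x" by blast
  define r where "r = x - blinfun_apply (proj E) x"
  show ?case
  proof (cases "r = 0")
    case True
    then show ?thesis using E by (intro exI[of _ E]) (auto simp: r_def)
  next
    case False
    define u where "u = r /\<^sub>R norm r"
    have re: "cinner r e = 0" if "e \<in> E" for e
      using orthonormal_cinner_proj[OF E(1) that] by (simp add: r_def cinner_simps)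
    then have ue: "cinner u e = 0" if "e \<in> E" for e
      using that by (simp add: u_def cinner_simps)
    then have eu: "cinner e u = 0" if "e \<in> E" for e
      using that by (metis cinner_commute complex_cnj_zero)
    have uu: "cinner u u = 1"
      using False by (simp add: cinner_same u_def)
    have "u \<notin> E" using ue uu by force
    have on: "orthonormal (insert u E)"
      using E(1) ue eu uu by (auto simp: orthonormal_def)
    have ap: "blinfun_apply (proj (insert u E)) h
        = cinner h u *\<^sub>C u + blinfun_apply (proj E) h" for h
      using \<open>u \<notin> E\<close> E(1) by (simp add: proj_apply orthonormal_def)
    have pu: "cinner (blinfun_apply (proj E) h) u = 0" for h
      by (simp add: proj_apply cinner_sum_left cinner_simps eu)
    have "cinner x u = cinner r u" using pu[of x] by (simp add: r_def cinner_simps)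
    also have "\<dots> = norm r" using False by (simp add: u_def cinner_simps cinner_same power2_eq_square)
    finally have "cinner x u *\<^sub>C u = r"
      using False by (simp add: u_def scaleR_scaleC scaleC_scaleC scaleC_one)
    then have "blinfun_apply (proj (insert u E)) x = x" by (simp add: ap r_def)
    moreover have "blinfun_apply (proj (insert u E)) y = y" if "y \<in> F" for y
      using pu[of y] E(2) that by (simp add: ap)
    ultimately show ?thesis using on by blast
  qed
qed

subsection \<open>Riesz representation\<close>

text \<open>A minimising sequence of \<open>\<parallel>x\<parallel>\<^sup>2 - 2 Re (g x)\<close> is Cauchy by the
  parallelogram law, and the vanishing of the first variation at its limit represents \<open>g\<close>.\<close>

lemma Riesz_representation:
  fixes g :: "'h::complex_hilbert_space \<Rightarrow> complex"
  assumes add: "\<And>x y. g (x + y) = g x + g y" and scale: "\<And>c x. g (c *\<^sub>C x) = c * g x"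
    and bound: "\<And>x. cmod (g x) \<le> K * norm x"
  shows "\<exists>y. \<forall>x. g x = cinner x y"
proof -
  define J where "J x = (norm x)\<^sup>2 - 2 * Re (g x)" for x
  have bl: "bounded_linear g"
    by (rule bounded_linear_intro[where K = K])
      (simp_all add: add scaleR_scaleC scale scaleR_conv_of_real bound mult.commute)
  have below: "- (K\<^sup>2) \<le> J x" for x
  proof -
    have "Re (g x) \<le> K * norm x" using bound complex_Re_le_cmod order_trans by blast
    moreover have "0 \<le> (norm x - K)\<^sup>2" by simp
    ultimately show ?thesis unfolding J_def by (simp add: power2_eq_square algebra_simps)
  qed
  define m where "m = (INF x. J x)"
  have bdd: "bdd_below (range J)" using below by (intro bdd_belowI) auto
  have m_le: "m \<le> J x" for x unfolding m_def using bdd by (rule cINF_lower) auto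
  have ex: "\<exists>x. J x < m + d" if "d > 0" for d
    using cINF_less_iff[OF _ bdd, of "m + d"] that by (auto simp: m_def)
  obtain s where s: "\<And>n. J (s n) < m + inverse (real (Suc n))"
    using ex[of "inverse (real (Suc _))"] by (metis inverse_positive_iff_positive of_nat_0_less_iff zero_less_Suc)
  have close: "(norm (a - b))\<^sup>2 \<le> 4 * d" if "J a < m + d" "J b < m + d" for a b d
  proof -
    have "J ((1/2) *\<^sub>R (a + b)) = (1/4) * (norm (a + b))\<^sup>2 - Re (g (a + b))"
    proof -
      have "g ((1/2) *\<^sub>R (a + b)) = (1/2) *\<^sub>R g (a + b)"
        by (metis bl bounded_linear.linear linear_scale)
      then show ?thesis
        by (simp add: J_def power_mult_distrib power2_eq_square del: scaleR_add_right)
    qed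
    moreover have "Re (g (a + b)) = Re (g a) + Re (g b)" by (simp add: add)
    moreover note m_le[of "(1/2) *\<^sub>R (a + b)"]
    ultimately have "m \<le> (1/4) * (norm (a + b))\<^sup>2 - (Re (g a) + Re (g b))" by simp
    then show ?thesis using parallelogram[of a b] that unfolding J_def
      by linarith
  qed
  have "Cauchy s"
  proof (rule metric_CauchyI)
    fix e :: real assume "e > 0"
    then obtain N where N: "inverse (real (Suc N)) < e\<^sup>2 / 4"
      using reals_Archimedean[of "e\<^sup>2 / 4"] by auto
    have "dist (s i) (s j) < e" if "i \<ge> N" "j \<ge> N" for i j
    proof -
      have le: "inverse (real (Suc k)) \<le> inverse (real (Suc N))" if "k \<ge> N" for k
        using that by (simp add: field_simps)
      have "(norm (s i - s j))\<^sup>2 \<le> 4 * inverse (real (Suc N))"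
        using s[of i] s[of j] le[OF that(1)] le[OF that(2)] by (intro close) linarith+
      also have "\<dots> < e\<^sup>2" using N by simp
      finally show ?thesis using \<open>e > 0\<close> by (auto simp: dist_norm intro: power2_less_imp_less)
    qed
    then show "\<exists>M. \<forall>i\<ge>M. \<forall>j\<ge>M. dist (s i) (s j) < e" by blast
  qed
  then obtain y where y: "s \<longlonglongrightarrow> y" using convergent_eq_Cauchy Cauchy_convergent convergent_def by metis
  have "(\<lambda>n. J (s n)) \<longlonglongrightarrow> J y"
    unfolding J_def by (intro tendsto_intros y bounded_linear.tendsto[OF bl])
  moreover have "(\<lambda>n. m + inverse (real (Suc n))) \<longlonglongrightarrow> m + 0"
    by (intro tendsto_intros LIMSEQ_inverse_real_of_nat)
  ultimately have Jy: "J y \<le> m"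
    using s by (intro LIMSEQ_le[where X = "\<lambda>n. J (s n)"]) (auto intro: less_imp_le)
  have var: "Re (cinner h y) = Re (g h)" for h
  proof (rule ccontr)
    assume ne: "Re (cinner h y) \<noteq> Re (g h)"
    define d where "d = Re (g h) - Re (cinner h y)"
    \<comment> \<open>close to the minimiser of \<open>- 2 t d + t\<^sup>2 \<parallel>h\<parallel>\<^sup>2\<close>; adding 1 covers \<open>h = 0\<close>\<close>
    define t where "t = d / ((norm h)\<^sup>2 + 1)"
    have pos: "(norm h)\<^sup>2 + 1 > 0" by (simp add: add_nonneg_pos)
    have "J (y + t *\<^sub>R h) = J y - 2 * t * d + t\<^sup>2 * (norm h)\<^sup>2"
    proof -
      have "g (t *\<^sub>R h) = t *\<^sub>R g h" by (metis bl bounded_linear.linear linear_scale)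
      moreover have "Re (cinner y h) = Re (cinner h y)" by (metis cinner_commute cnj.sel(1))
      ultimately show ?thesis
        by (simp add: J_def norm_add_sq add cinner_simps d_def power_mult_distrib algebra_simps)
    qed
    moreover have "t\<^sup>2 * (norm h)\<^sup>2 \<le> t\<^sup>2 * ((norm h)\<^sup>2 + 1)" by (intro mult_left_mono) auto
    moreover have "t\<^sup>2 * ((norm h)\<^sup>2 + 1) = t * d"
      using pos by (simp add: t_def power2_eq_square)
    moreover have "t * d > 0"
    proof -
      have "t * d = d\<^sup>2 / ((norm h)\<^sup>2 + 1)" by (simp add: t_def power2_eq_square)
      moreover have "d \<noteq> 0" using ne by (simp add: d_def)
      ultimately show ?thesis using pos by simp
    qed
    ultimately show False using m_le[of "y + t *\<^sub>R h"] Jy by linarith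
  qed
  have "g h = cinner h y" for h
  proof (rule complex_eqI)
    show "Re (g h) = Re (cinner h y)" using var by simp
    show "Im (g h) = Im (cinner h y)"
      using var[of "\<i> *\<^sub>C h"] by (simp add: scale cinner_simps)
  qed
  then show ?thesis by blast
qed

section \<open>Norm-preserving extension of functionals\<close>

definition sublinear :: "('a::real_vector \<Rightarrow> real) \<Rightarrow> bool" where
  "sublinear p \<longleftrightarrow> (\<forall>x y. p (x + y) \<le> p x + p y) \<and> (\<forall>t\<ge>0. \<forall>x. p (t *\<^sub>R x) \<le> t * p x)"

lemma sublinear_zero: "sublinear p \<Longrightarrow> p 0 = 0"
  unfolding sublinear_def
  by (metis add.right_neutral add_le_cancel_left antisym mult_zero_left order_refl scaleR_zero_left)

lemma sublinear_minus: "sublinear p \<Longrightarrow> - p (- x) \<le> p x"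
  using sublinear_zero[of p] unfolding sublinear_def
  by (metis add.right_inverse minus_le_iff neg_le_iff_le le_minus_iff add_le_same_cancel1
      add.commute diff_ge_0_iff_ge diff_minus_eq_add)

text \<open>A chain of sublinear functionals below \<open>p\<close> has the pointwise infimum as a lower bound.  The
  chain condition enters in subadditivity: the bound \<open>q x + r y\<close> with two different members is
  improved by the smaller of the two.\<close>

lemma sublinear_chain_Inf:
  assumes C: "C \<noteq> {}" "\<And>q. q \<in> C \<Longrightarrow> sublinear q" "\<And>q x. q \<in> C \<Longrightarrow> q x \<le> p x"
    and chain: "\<And>q r. q \<in> C \<Longrightarrow> r \<in> C \<Longrightarrow> q \<le> r \<or> r \<le> q"
  shows "sublinear (\<lambda>x. INF q\<in>C. q x)" and "\<And>q x. q \<in> C \<Longrightarrow> (INF q\<in>C. q x) \<le> q x"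
proof -
  have bdd: "bdd_below ((\<lambda>q. q x) ` C)" for x
  proof (rule bdd_belowI2)
    fix q assume q: "q \<in> C"
    show "- p (- x) \<le> q x" using sublinear_minus[OF C(2)[OF q], of x] C(3)[OF q, of "- x"] by linarith
  qed
  show lower: "(INF q\<in>C. q x) \<le> q x" if "q \<in> C" for q x
    using bdd that by (rule cINF_lower)
  show "sublinear (\<lambda>x. INF q\<in>C. q x)"
    unfolding sublinear_def
  proof (intro conjI allI impI)
    fix x y
    have step: "(INF q\<in>C. q (x + y)) \<le> q x + r y" if qr: "q \<in> C" "r \<in> C" for q r
    proof -
      obtain s where s: "s \<in> C" "s \<le> q" "s \<le> r" using chain[OF qr] qr by auto
      have "(INF q\<in>C. q (x + y)) \<le> s (x + y)" using lower[OF s(1)] .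
      also have "\<dots> \<le> s x + s y" using C(2)[OF s(1)] by (simp add: sublinear_def)
      also have "\<dots> \<le> q x + r y" using s by (intro add_mono) (auto simp: le_fun_def)
      finally show ?thesis .
    qed
    have "(INF q\<in>C. q (x + y)) - (INF q\<in>C. q x) \<le> r y" if "r \<in> C" for r
    proof -
      have "(INF q\<in>C. q (x + y)) - r y \<le> (INF q\<in>C. q x)"
        using step that C(1) by (intro cINF_greatest) (auto simp: algebra_simps)
      then show ?thesis by linarith
    qed
    then have "(INF q\<in>C. q (x + y)) - (INF q\<in>C. q x) \<le> (INF r\<in>C. r y)"
      using C(1) by (intro cINF_greatest) auto
    then show "(INF q\<in>C. q (x + y)) \<le> (INF q\<in>C. q x) + (INF q\<in>C. q y)" by linarith
  next
    fix t :: real and x assume t: "t \<ge> 0"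
    have step: "(INF q\<in>C. q (t *\<^sub>R x)) \<le> t * q x" if "q \<in> C" for q
      using lower[OF that] C(2)[OF that] t unfolding sublinear_def by (meson order_trans)
    show "(INF q\<in>C. q (t *\<^sub>R x)) \<le> t * (INF q\<in>C. q x)"
    proof (cases "t = 0")
      case True
      then show ?thesis using step C(1) by auto
    next
      case False
      have "(INF q\<in>C. q (t *\<^sub>R x)) / t \<le> (INF q\<in>C. q x)"
        using step C(1) t False by (intro cINF_greatest) (auto simp: field_simps)
      then show ?thesis using t False by (simp add: field_simps)
    qed
  qed
qed

text \<open>The functional \<open>r y = inf\<^bsub>t \<ge> 0\<^esub> m (y + t v) - t m v\<close> is sublinear and at most \<open>m\<close>, so
  minimality gives \<open>r = m\<close>; the term \<open>t = 1\<close> is then superadditivity of \<open>m\<close>.\<close>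

lemma minimal_sublinear_additive:
  assumes m: "sublinear m" and minimal: "\<And>q. sublinear q \<Longrightarrow> q \<le> m \<Longrightarrow> q = m"
  shows "m (y + v) = m y + m v"
proof -
  define r where "r y = (INF t\<in>{0..}. m (y + t *\<^sub>R v) - t * m v)" for y
  have sub: "m (a + b) \<le> m a + m b" and hom: "t \<ge> 0 \<Longrightarrow> m (t *\<^sub>R a) \<le> t * m a" for a b t
    using m by (auto simp: sublinear_def)
  have hom_eq: "m (t *\<^sub>R a) = t * m a" if "t \<ge> 0" for t a
  proof (cases "t = 0")
    case False
    then have "m (inverse t *\<^sub>R (t *\<^sub>R a)) \<le> inverse t * m (t *\<^sub>R a)" using that by (intro hom) auto
    then have "t * m a \<le> m (t *\<^sub>R a)" using False that by (simp add: field_simps)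
    then show ?thesis using hom[OF that] by (intro antisym) auto
  qed (simp add: sublinear_zero[OF m])
  have bdd: "bdd_below ((\<lambda>t. m (y + t *\<^sub>R v) - t * m v) ` {0..})" for y
  proof (rule bdd_belowI2)
    fix t :: real assume "t \<in> {0..}"
    then have "t * m v = m (t *\<^sub>R v)" by (simp add: hom_eq)
    also have "\<dots> \<le> m (y + t *\<^sub>R v) + m (- y)" using sub[of "y + t *\<^sub>R v" "- y"] by simp
    finally show "- m (- y) \<le> m (y + t *\<^sub>R v) - t * m v" by linarith
  qed
  have lower: "r y \<le> m (y + t *\<^sub>R v) - t * m v" if "t \<ge> 0" for y t
    unfolding r_def using bdd that by (intro cINF_lower) auto
  have r_le: "r y \<le> m y" for y using lower[of 0 y] by simp
  have "sublinear r"
    unfolding sublinear_def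
  proof (intro conjI allI impI)
    fix x y
    have step: "r (x + y) \<le> (m (x + s *\<^sub>R v) - s * m v) + (m (y + t *\<^sub>R v) - t * m v)"
      if "s \<ge> 0" "t \<ge> 0" for s t
    proof -
      have "r (x + y) \<le> m ((x + s *\<^sub>R v) + (y + t *\<^sub>R v)) - (s + t) * m v"
        using lower[of "s + t" "x + y"] that by (simp add: algebra_simps)
      then show ?thesis using sub[of "x + s *\<^sub>R v" "y + t *\<^sub>R v"] by (simp add: algebra_simps)
    qed
    have "r (x + y) - r x \<le> m (y + t *\<^sub>R v) - t * m v" if "t \<ge> 0" for t
    proof -
      have "r (x + y) - (m (y + t *\<^sub>R v) - t * m v) \<le> r x"
        unfolding r_def[of x] using step that by (intro cINF_greatest) (auto simp: algebra_simps)
      then show ?thesis by linarith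
    qed
    then have "r (x + y) - r x \<le> r y"
      unfolding r_def[of y] by (intro cINF_greatest) auto
    then show "r (x + y) \<le> r x + r y" by linarith
  next
    fix s :: real and x assume s: "s \<ge> 0"
    show "r (s *\<^sub>R x) \<le> s * r x"
    proof (cases "s = 0")
      case True
      then show ?thesis using r_le[of 0] by (simp add: sublinear_zero[OF m])
    next
      case False
      have "r (s *\<^sub>R x) / s \<le> r x"
        unfolding r_def[of x]
      proof (rule cINF_greatest)
        fix t :: real assume "t \<in> {0..}"
        then have "r (s *\<^sub>R x) \<le> m (s *\<^sub>R (x + t *\<^sub>R v)) - (s * t) * m v"
          using lower[of "s * t" "s *\<^sub>R x"] s by (simp add: algebra_simps)
        also have "\<dots> = s * (m (x + t *\<^sub>R v) - t * m v)"
          unfolding hom_eq[OF s] by (simp add: algebra_simps)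
        finally show "r (s *\<^sub>R x) / s \<le> m (x + t *\<^sub>R v) - t * m v"
          using s False by (simp add: field_simps)
      qed auto
      then show ?thesis using s False by (simp add: field_simps)
    qed
  qed
  then have "r = m" using minimal r_le by (auto simp: le_fun_def)
  then have "m y + m v \<le> m (y + v)" using lower[of 1 y] by simp
  then show ?thesis using sub by (intro antisym) auto
qed

text \<open>Zorn's lemma yields a minimal sublinear functional below \<open>p\<close>.  Working with functionals on the
  whole space instead of partially defined linear ones avoids the one-dimensional extension step of
  the usual proof.\<close>

theorem linear_below_sublinear:
  assumes "sublinear p"
  shows "\<exists>q. linear q \<and> (\<forall>x. q x \<le> p x)"
proof -
  let ?A = "{q. sublinear q \<and> q \<le> p}"
  let ?P = "\<lambda>a b :: 'a \<Rightarrow> real. b \<le> a"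
  have "\<exists>m\<in>?A. \<forall>a\<in>?A. ?P m a \<longrightarrow> a = m"
  proof (rule predicate_Zorn)
    show "partial_order_on ?A (relation_of ?P ?A)"
      by (rule partial_order_on_relation_ofI) auto
    fix C assume C: "C \<in> Chains (relation_of ?P ?A)"
    then have CA: "C \<subseteq> ?A" and chain: "\<And>q r. q \<in> C \<Longrightarrow> r \<in> C \<Longrightarrow> q \<le> r \<or> r \<le> q"
      by (auto simp: Chains_def relation_of_def)
    show "\<exists>u\<in>?A. \<forall>a\<in>C. ?P a u"
    proof (cases "C = {}")
      case True
      then show ?thesis using assms by auto
    next
      case False
      have ge: "\<And>q x. q \<in> C \<Longrightarrow> q x \<le> p x" using CA by (auto simp: le_fun_def)
      let ?u = "\<lambda>x. INF q\<in>C. q x"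
      have sub: "\<And>q. q \<in> C \<Longrightarrow> sublinear q" using CA by auto
      have "sublinear ?u" 
        by (rule sublinear_chain_Inf(1)[where p = p]) (use False sub ge chain in auto)
      moreover have low: "?u x \<le> q x" if "q \<in> C" for q x
        by (rule sublinear_chain_Inf(2)[where p = p]) (use False sub ge chain that in auto)
      moreover have "?u \<le> p" using False low ge by (metis (no_types, lifting) ex_in_conv le_funI order_trans)
      ultimately show ?thesis by (intro bexI[of _ ?u]) (auto simp: le_fun_def)
    qed
  qed
  then obtain m where m: "sublinear m" "m \<le> p" and min: "\<And>q. sublinear q \<Longrightarrow> q \<le> m \<Longrightarrow> q = m"
    by (auto intro: order_trans)
  have add: "m (x + y) = m x + m y" for x y
    using minimal_sublinear_additive[OF m(1) min] .
  have neg: "m (- x) = - m x" for x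
    using add[of x "- x"] sublinear_zero[OF m(1)] by simp
  have pos: "m (t *\<^sub>R x) = t * m x" if "t \<ge> 0" for t x
  proof -
    have "m (t *\<^sub>R y) \<le> t * m y" for y using m(1) that by (simp add: sublinear_def)
    from this[of x] this[of "- x"] show ?thesis by (simp add: neg)
  qed
  have "linear m"
  proof (rule linearI)
    show "m (t *\<^sub>R x) = t *\<^sub>R m x" for t x
      using pos[of t x] pos[of "- t" x] neg[of "t *\<^sub>R x"] by (cases "t \<ge> 0") auto
  qed (rule add)
  then show ?thesis using m(2) by (auto simp: le_fun_def)
qed

text \<open>A linear functional below \<open>p y = inf\<^bsub>x \<in> X\<^esub> g x + K \<parallel>y - x\<parallel>\<close> is below \<open>g\<close> on \<open>X\<close> and below
  \<open>K \<parallel>\<cdot>\<parallel>\<close> everywhere; by linearity it then equals \<open>g\<close> on \<open>X\<close>.\<close>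

theorem Hahn_Banach_real:
  fixes g :: "'a::real_normed_vector \<Rightarrow> real"
  assumes X: "subspace X" and K: "K \<ge> 0"
    and add: "\<And>x y. x \<in> X \<Longrightarrow> y \<in> X \<Longrightarrow> g (x + y) = g x + g y"
    and scale: "\<And>t x. x \<in> X \<Longrightarrow> g (t *\<^sub>R x) = t * g x"
    and bound: "\<And>x. x \<in> X \<Longrightarrow> g x \<le> K * norm x"
  shows "\<exists>G. linear G \<and> (\<forall>x\<in>X. G x = g x) \<and> (\<forall>x. G x \<le> K * norm x)"
proof -
  define p where "p y = (INF x\<in>X. g x + K * norm (y - x))" for y
  have X0: "0 \<in> X" and Xadd: "\<And>x y. x \<in> X \<Longrightarrow> y \<in> X \<Longrightarrow> x + y \<in> X"
    and Xscale: "\<And>t x. x \<in> X \<Longrightarrow> t *\<^sub>R x \<in> X"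
    using X by (auto simp: subspace_0 subspace_add subspace_scale)
  have g0: "g 0 = 0" using scale[OF X0, of 0] by simp
  have gneg: "g (- x) = - g x" if "x \<in> X" for x using scale[OF that, of "- 1"] by simp
  have bdd: "bdd_below ((\<lambda>x. g x + K * norm (y - x)) ` X)" for y
  proof (rule bdd_belowI2)
    fix x assume x: "x \<in> X"
    have "- g x \<le> K * norm x" using bound[of "- x"] Xscale[OF x, of "- 1"] gneg[OF x] by simp
    also have "\<dots> \<le> K * (norm y + norm (y - x))"
      using K norm_triangle_sub[of x y] by (intro mult_left_mono) (auto simp: norm_minus_commute)
    finally show "- (K * norm y) \<le> g x + K * norm (y - x)" by (simp add: distrib_left)
  qed
  have lower: "p y \<le> g x + K * norm (y - x)" if "x \<in> X" for x y
    unfolding p_def using bdd that by (rule cINF_lower)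
  have ne: "X \<noteq> {}" using X0 by auto
  have "sublinear p"
    unfolding sublinear_def
  proof (intro conjI allI impI)
    fix y z
    have step: "p (y + z) \<le> (g a + K * norm (y - a)) + (g b + K * norm (z - b))"
      if "a \<in> X" "b \<in> X" for a b
    proof -
      have "norm (y + z - (a + b)) \<le> norm (y - a) + norm (z - b)"
        using norm_triangle_ineq[of "y - a" "z - b"] by (simp add: algebra_simps)
      then have "K * norm (y + z - (a + b)) \<le> K * norm (y - a) + K * norm (z - b)"
        using K by (metis distrib_left mult_left_mono)
      then show ?thesis using lower[OF Xadd[OF that], of "y + z"] add[OF that] by linarith
    qed
    have "p (y + z) - p y \<le> g b + K * norm (z - b)" if "b \<in> X" for b
    proof -
      have "p (y + z) - (g b + K * norm (z - b)) \<le> p y"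
        unfolding p_def[of y] using step[OF _ that] ne by (intro cINF_greatest) (auto simp: algebra_simps)
      then show ?thesis by linarith
    qed
    then have "p (y + z) - p y \<le> p z"
      unfolding p_def[of z] using ne by (intro cINF_greatest) auto
    then show "p (y + z) \<le> p y + p z" by linarith
  next
    fix t :: real and y assume t: "t \<ge> 0"
    show "p (t *\<^sub>R y) \<le> t * p y"
    proof (cases "t = 0")
      case True
      then show ?thesis using lower[OF X0, of 0] by (simp add: g0)
    next
      case False
      have "p (t *\<^sub>R y) / t \<le> p y"
        unfolding p_def[of y]
      proof (rule cINF_greatest[OF ne])
        fix x assume x: "x \<in> X"
        have "norm (t *\<^sub>R y - t *\<^sub>R x) = t * norm (y - x)"
          using t by (simp flip: scaleR_diff_right)
        then have "p (t *\<^sub>R y) \<le> t * g x + K * (t * norm (y - x))"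
          using lower[OF Xscale[OF x, of t], of "t *\<^sub>R y"] scale[OF x, of t] by simp
        then show "p (t *\<^sub>R y) / t \<le> g x + K * norm (y - x)"
          using t False by (simp add: field_simps)
      qed
      then show ?thesis using t False by (simp add: field_simps)
    qed
  qed
  then obtain G where G: "linear G" "\<And>x. G x \<le> p x" using linear_below_sublinear by blast
  have le: "G x \<le> g x" if "x \<in> X" for x
    using G(2)[of x] lower[OF that, of x] by simp
  have "G x = g x" if "x \<in> X" for x
    using le[OF that] le[of "- x"] Xscale[OF that, of "- 1"] gneg[OF that] linear_neg[OF G(1), of x] by simp
  moreover have "G x \<le> K * norm x" for x
    using G(2)[of x] lower[OF X0, of x] by (simp add: g0)
  ultimately show ?thesis using G(1) by blast
qed

subsection \<open>Complex functionals on spaces of operators\<close>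

lemma op_scaleC_add_right: "op_scaleC c (S + T) = op_scaleC c S + op_scaleC c T"
  by (rule blinfun_eqI) (simp add: blinfun.add_left scaleC_add_right)

lemma op_scaleC_add_left: "op_scaleC (c + d) T = op_scaleC c T + op_scaleC d T"
  by (rule blinfun_eqI) (simp add: blinfun.add_left scaleC_add_left)

lemma op_scaleC_op_scaleC: "op_scaleC c (op_scaleC d T) = op_scaleC (c * d) T"
  by (rule blinfun_eqI) (simp add: scaleC_scaleC)

lemma op_scaleC_of_real: "op_scaleC (complex_of_real r) T = r *\<^sub>R T"
  by (rule blinfun_eqI) (simp add: blinfun.scaleR_left scaleR_scaleC)

lemma op_scaleC_one: "op_scaleC 1 T = T"
  by (rule blinfun_eqI) (simp add: scaleC_one)

lemma norm_op_scaleC: "norm (op_scaleC c T) = cmod c * norm T"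
proof -
  have le: "norm (op_scaleC c T) \<le> cmod c * norm T" for c and T :: "'a \<Rightarrow>\<^sub>L 'a"
    by (rule norm_blinfun_bound)
      (auto simp: norm_scaleC mult.assoc intro: mult_left_mono norm_blinfun)
  show ?thesis
  proof (cases "c = 0")
    case False
    have "norm T = norm (op_scaleC (inverse c) (op_scaleC c T))"
      using False by (simp add: op_scaleC_op_scaleC op_scaleC_one)
    also have "\<dots> \<le> inverse (cmod c) * norm (op_scaleC c T)"
      using le[of "inverse c"] by (simp add: norm_inverse)
    finally show ?thesis using False le[of c T] by (simp add: field_simps)
  qed (use le[of 0 T] in simp)
qed

lemma op_subspace_bounded_ops: "op_subspace bounded_ops"
  by (auto simp: op_subspace_def bounded_ops_def blinfun.add_left scaleC_add_right scaleC_scaleC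
      mult.commute)

lemma bounded_ops_closed:
  shows "0 \<in> bounded_ops" and "S \<in> bounded_ops \<Longrightarrow> T \<in> bounded_ops \<Longrightarrow> S + T \<in> bounded_ops"
    and "T \<in> bounded_ops \<Longrightarrow> op_scaleC c T \<in> bounded_ops"
  using op_subspace_bounded_ops by (auto simp: op_subspace_def)

lemma op_subspace_scaleR: "op_subspace X \<Longrightarrow> T \<in> X \<Longrightarrow> r *\<^sub>R T \<in> X"
  by (metis op_scaleC_of_real op_subspace_def)

lemma op_subspace_diff: "op_subspace X \<Longrightarrow> S \<in> X \<Longrightarrow> T \<in> X \<Longrightarrow> S - T \<in> X"
  using op_subspace_scaleR[of X T "- 1"] unfolding op_subspace_def
  by (metis diff_conv_add_uminus scaleR_minus1_left)

lemma op_subspace_sum: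
  "op_subspace X \<Longrightarrow> (\<And>i. i \<in> I \<Longrightarrow> f i \<in> X) \<Longrightarrow> (\<Sum>i\<in>I. f i) \<in> X"
  by (induction I rule: infinite_finite_induct) (auto simp: op_subspace_def)

lemma linear_functional_diff:
  assumes "op_subspace X" "linear_functional X \<phi>" "S \<in> X" "T \<in> X"
  shows "\<phi> (S - T) = \<phi> S - \<phi> T"
proof -
  have "\<phi> ((S - T) + T) = \<phi> (S - T) + \<phi> T"
    using assms(2,4) op_subspace_diff[OF assms(1,3,4)] unfolding linear_functional_def by blast
  then show ?thesis by simp
qed

lemma linear_functional_sum:
  assumes "op_subspace X" "linear_functional X \<phi>" "\<And>i. i \<in> I \<Longrightarrow> f i \<in> X"
  shows "\<phi> (\<Sum>i\<in>I. f i) = (\<Sum>i\<in>I. \<phi> (f i))"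
proof -
  have "\<phi> 0 = 0"
    using linear_functional_diff[OF assms(1,2), of 0 0] assms(1) by (simp add: op_subspace_def)
  then show ?thesis using assms(3)
  proof (induction I rule: infinite_finite_induct)
    case (insert i I)
    then have "(\<Sum>i\<in>I. f i) \<in> X" by (intro op_subspace_sum[OF assms(1)]) auto
    then show ?case using insert assms(2) by (auto simp: linear_functional_def)
  qed auto
qed

lemma dual_bdd_above:
  assumes \<phi>: "\<phi> \<in> dual X"
  shows "bdd_above ((\<lambda>T. cmod (\<phi> T)) ` {T \<in> X. norm T \<le> 1})"
proof -
  obtain K where K: "\<forall>T\<in>X. cmod (\<phi> T) \<le> K * norm T" using \<phi> by (auto simp: dual_def)
  show ?thesis
  proof (rule bdd_aboveI2)
    fix S assume S: "S \<in> {T \<in> X. norm T \<le> 1}"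
    have "cmod (\<phi> S) \<le> K * norm S" using K S by auto
    also have "\<dots> \<le> \<bar>K\<bar> * norm S" by (intro mult_right_mono) auto
    also have "\<dots> \<le> \<bar>K\<bar>" using S by (intro mult_left_le) auto
    finally show "cmod (\<phi> S) \<le> \<bar>K\<bar>" .
  qed
qed

lemma dual_norm_bound:
  assumes X: "op_subspace X" and \<phi>: "\<phi> \<in> dual X" and T: "T \<in> X"
  shows "cmod (\<phi> T) \<le> dual_norm X \<phi> * norm T"
proof (cases "T = 0")
  case True
  then show ?thesis
    using linear_functional_diff[OF X, of \<phi> 0 0] \<phi> T by (simp add: dual_def)
next
  case False
  let ?c = "complex_of_real (inverse (norm T))"
  have "op_scaleC ?c T \<in> X" using X T by (simp add: op_subspace_def)
  moreover have "norm (op_scaleC ?c T) \<le> 1" using False by (simp add: norm_op_scaleC norm_inverse)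
  ultimately have "cmod (\<phi> (op_scaleC ?c T)) \<le> dual_norm X \<phi>"
    unfolding dual_norm_def using dual_bdd_above[OF \<phi>] by (intro cSUP_upper) auto
  moreover have "\<phi> (op_scaleC ?c T) = ?c * \<phi> T"
    using \<phi> T by (simp add: dual_def linear_functional_def)
  ultimately have "inverse (norm T) * cmod (\<phi> T) \<le> dual_norm X \<phi>"
    by (simp only: norm_mult norm_of_real) simp
  then show ?thesis using False by (simp add: field_simps)
qed

lemma dual_norm_least:
  assumes "op_subspace X" and "\<And>T. T \<in> X \<Longrightarrow> norm T \<le> 1 \<Longrightarrow> cmod (\<phi> T) \<le> K"
  shows "dual_norm X \<phi> \<le> K"
  unfolding dual_norm_def using assms by (intro cSUP_least) (auto simp: op_subspace_def)

lemma dual_norm_nonneg: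
  assumes "op_subspace X" "\<phi> \<in> dual X"
  shows "0 \<le> dual_norm X \<phi>"
proof -
  have "cmod (\<phi> 0) \<le> dual_norm X \<phi>"
    unfolding dual_norm_def using assms(1) dual_bdd_above[OF assms(2)]
    by (intro cSUP_upper) (auto simp: op_subspace_def)
  then show ?thesis using norm_ge_zero order_trans by blast
qed

text \<open>A complex functional is recovered from its real part \<open>G\<close> as \<open>G T - i G (i T)\<close>, and a rotation
  shows that it has the norm of its real part.\<close>

theorem Hahn_Banach_operators:
  fixes X :: "('h::complex_hilbert_space \<Rightarrow>\<^sub>L 'h) set"
  assumes X: "op_subspace X" and \<phi>: "\<phi> \<in> dual X"
  shows "\<exists>\<psi>\<in>dual bounded_ops. restrict_functional X \<psi> = \<phi> \<and>
    dual_norm bounded_ops \<psi> \<le> dual_norm X \<phi>"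
proof -
  define K where "K = dual_norm X \<phi>"
  have K: "K \<ge> 0" unfolding K_def using dual_norm_nonneg[OF X \<phi>] .
  have lin: "linear_functional X \<phi>" using \<phi> by (simp add: dual_def)
  have scale: "\<phi> (op_scaleC c T) = c * \<phi> T" if "T \<in> X" for c T
    using lin that by (simp add: linear_functional_def)
  have Xs: "op_scaleC c T \<in> X" if "T \<in> X" for c T
    using X that by (simp add: op_subspace_def)
  have "\<exists>G. linear G \<and> (\<forall>T\<in>X. G T = Re (\<phi> T)) \<and> (\<forall>T. G T \<le> K * norm T)"
  proof (rule Hahn_Banach_real[OF _ K])
    show "subspace X" using X op_subspace_scaleR[OF X] by (auto simp: subspace_def op_subspace_def)
    show "Re (\<phi> (S + T)) = Re (\<phi> S) + Re (\<phi> T)" if "S \<in> X" "T \<in> X" for S T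
      using lin that by (simp add: linear_functional_def)
    show "Re (\<phi> (t *\<^sub>R T)) = t * Re (\<phi> T)" if "T \<in> X" for t T
      using scale[OF that, of "complex_of_real t"] by (simp add: op_scaleC_of_real)
    show "Re (\<phi> T) \<le> K * norm T" if "T \<in> X" for T
      using dual_norm_bound[OF X \<phi> that] complex_Re_le_cmod[of "\<phi> T"] unfolding K_def by linarith
  qed
  then obtain G where G: "linear G" "\<And>T. T \<in> X \<Longrightarrow> G T = Re (\<phi> T)" "\<And>T. G T \<le> K * norm T"
    by blast
  define \<psi> where "\<psi> T = (if T \<in> bounded_ops then Complex (G T) (- G (op_scaleC \<i> T)) else 0)" for T
  have Gc: "G (op_scaleC c T) = Re c * G T + Im c * G (op_scaleC \<i> T)" for c T
  proof -
    have "op_scaleC c T = op_scaleC (complex_of_real (Re c)) T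
        + op_scaleC (complex_of_real (Im c)) (op_scaleC \<i> T)"
      unfolding op_scaleC_op_scaleC op_scaleC_add_left[symmetric]
      by (metis complex_eq mult.commute)
    then show ?thesis
      unfolding op_scaleC_of_real by (simp add: linear_add[OF G(1)] linear_scale[OF G(1)])
  qed
  have Bs: "op_scaleC c T \<in> bounded_ops" if "T \<in> bounded_ops" for c T
    using op_subspace_bounded_ops that by (auto simp: op_subspace_def)
  have psi_scale: "\<psi> (op_scaleC c T) = c * \<psi> T" if "T \<in> bounded_ops" for c T
  proof -
    have "G (op_scaleC \<i> (op_scaleC c T)) = - Im c * G T + Re c * G (op_scaleC \<i> T)"
      unfolding op_scaleC_op_scaleC Gc[of "\<i> * c"] by simp
    then show ?thesis using that Bs[OF that] Gc[of c T]
      by (auto simp: \<psi>_def complex_eq_iff algebra_simps)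
  qed
  have psi_lin: "linear_functional bounded_ops \<psi>"
    unfolding linear_functional_def
  proof (intro conjI ballI allI impI)
    show "\<psi> (S + T) = \<psi> S + \<psi> T" if "S \<in> bounded_ops" "T \<in> bounded_ops" for S T
    proof -
      have "S + T \<in> bounded_ops" using that op_subspace_bounded_ops by (auto simp: op_subspace_def)
      then show ?thesis using that
        by (simp add: \<psi>_def op_scaleC_add_right linear_add[OF G(1)] complex_eq_iff)
    qed
  qed (auto simp: psi_scale, simp add: \<psi>_def)
  have psi_bound: "cmod (\<psi> T) \<le> K * norm T" if T: "T \<in> bounded_ops" for T
  proof -
    obtain c where c: "cmod c = 1" "c * \<psi> T = complex_of_real (cmod (\<psi> T))"
      using phase_exists by blast
    have "cmod (\<psi> T) = Re (\<psi> (op_scaleC c T))" using c T by (simp add: psi_scale)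
    also have "\<dots> = G (op_scaleC c T)" using Bs[OF T] by (simp add: \<psi>_def)
    also have "\<dots> \<le> K * norm T" using G(3)[of "op_scaleC c T"] c by (simp add: norm_op_scaleC)
    finally show ?thesis .
  qed
  have "\<psi> \<in> dual bounded_ops" using psi_lin psi_bound by (auto simp: dual_def)
  moreover have "restrict_functional X \<psi> = \<phi>"
  proof
    fix T
    show "restrict_functional X \<psi> T = \<phi> T"
    proof (cases "T \<in> X")
      case True
      then have "T \<in> bounded_ops" using X by (auto simp: op_subspace_def)
      then show ?thesis
        using True G(2)[OF True] G(2)[OF Xs[OF True, of \<i>]] scale[OF True, of \<i>]
        by (simp add: restrict_functional_def \<psi>_def complex_eq_iff)
    next
      case False
      then show ?thesis using lin by (simp add: restrict_functional_def linear_functional_def)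
    qed
  qed
  moreover have "dual_norm bounded_ops \<psi> \<le> K"
  proof (rule dual_norm_least[OF op_subspace_bounded_ops])
    fix T :: "'h \<Rightarrow>\<^sub>L 'h" assume T: "T \<in> bounded_ops" "norm T \<le> 1"
    have "K * norm T \<le> K" using K T by (intro mult_left_le) auto
    then show "cmod (\<psi> T) \<le> K" using psi_bound[OF T(1)] by linarith
  qed
  ultimately show ?thesis unfolding K_def by blast
qed

section \<open>Compact operators\<close>

lemma bounded_opsD: "T \<in> bounded_ops \<Longrightarrow> blinfun_apply T (c *\<^sub>C x) = c *\<^sub>C blinfun_apply T x"
  by (simp add: bounded_ops_def)

lemma compact_ops_bounded: "T \<in> compact_ops \<Longrightarrow> T \<in> bounded_ops"
  by (simp add: compact_ops_def)

lemma compact_opsI: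
  assumes "T \<in> bounded_ops" "compact C" "blinfun_apply T ` cball 0 1 \<subseteq> C"
  shows "T \<in> compact_ops"
proof -
  have "closure (blinfun_apply T ` cball 0 1) \<subseteq> C"
    using assms by (simp add: closure_minimal compact_imp_closed)
  then have "compact (closure (blinfun_apply T ` cball 0 1))"
    using assms(2) by (metis closed_closure compact_Int_closed inf.absorb_iff2)
  then show ?thesis using assms(1) by (simp add: compact_ops_def)
qed

lemma compact_opsE:
  assumes "T \<in> compact_ops"
  obtains C where "compact C" "\<And>x. norm x \<le> 1 \<Longrightarrow> blinfun_apply T x \<in> C"
proof
  show "compact (closure (blinfun_apply T ` cball 0 1))" using assms by (simp add: compact_ops_def)
  show "blinfun_apply T x \<in> closure (blinfun_apply T ` cball 0 1)" if "norm x \<le> 1" for x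
    using that by (intro closure_subset[THEN subsetD]) auto
qed

lemma bounded_linear_scaleC: "bounded_linear (\<lambda>x::'h::complex_hilbert_space. c *\<^sub>C x)"
  by (rule bounded_linear_intro[where K = "cmod c"])
    (simp_all add: scaleC_add_right scaleC_scaleR_commute norm_scaleC mult.commute)

lemma op_subspace_compact_ops: "op_subspace compact_ops"
  unfolding op_subspace_def
proof (intro conjI ballI allI)
  show "(compact_ops :: ('a \<Rightarrow>\<^sub>L 'a) set) \<subseteq> bounded_ops" by (auto simp: compact_ops_def)
  show "(0 :: 'a \<Rightarrow>\<^sub>L 'a) \<in> compact_ops"
    by (rule compact_opsI[of _ "{0}"]) (auto simp: bounded_ops_def)
next
  fix S T :: "'a \<Rightarrow>\<^sub>L 'a" assume S: "S \<in> compact_ops" and T: "T \<in> compact_ops"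
  obtain C where C: "compact C" "\<And>x. norm x \<le> 1 \<Longrightarrow> blinfun_apply S x \<in> C"
    using compact_opsE[OF S] by blast
  obtain D where D: "compact D" "\<And>x. norm x \<le> 1 \<Longrightarrow> blinfun_apply T x \<in> D"
    using compact_opsE[OF T] by blast
  show "S + T \<in> compact_ops"
  proof (rule compact_opsI)
    show "S + T \<in> bounded_ops"
      using S T op_subspace_bounded_ops by (auto simp: op_subspace_def dest: compact_ops_bounded)
    show "compact {x + y | x y. x \<in> C \<and> y \<in> D}" using C D by (intro compact_sums)
  qed (use C D in \<open>force simp: blinfun.add_left\<close>)
next
  fix c and T :: "'a \<Rightarrow>\<^sub>L 'a" assume T: "T \<in> compact_ops"
  obtain C where C: "compact C" "\<And>x. norm x \<le> 1 \<Longrightarrow> blinfun_apply T x \<in> C"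
    using compact_opsE[OF T] by blast
  show "op_scaleC c T \<in> compact_ops"
  proof (rule compact_opsI)
    show "op_scaleC c T \<in> bounded_ops"
      using compact_ops_bounded[OF T] op_subspace_bounded_ops by (auto simp: op_subspace_def)
    show "compact ((\<lambda>x. c *\<^sub>C x) ` C)"
      using C(1) by (intro compact_continuous_image linear_continuous_on bounded_linear_scaleC)
  qed (use C in auto)
qed

lemma bounded_ops_compose: "A \<in> bounded_ops \<Longrightarrow> T \<in> bounded_ops \<Longrightarrow> A o\<^sub>L T \<in> bounded_ops"
  by (simp add: bounded_ops_def)

lemma compact_ops_compose_left:
  assumes A: "A \<in> bounded_ops" and T: "T \<in> compact_ops"
  shows "A o\<^sub>L T \<in> compact_ops"
proof -
  obtain C where C: "compact C" "\<And>x. norm x \<le> 1 \<Longrightarrow> blinfun_apply T x \<in> C"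
    using compact_opsE[OF T] by blast
  show ?thesis
  proof (rule compact_opsI)
    show "A o\<^sub>L T \<in> bounded_ops" by (rule bounded_ops_compose[OF A compact_ops_bounded[OF T]])
    show "compact (blinfun_apply A ` C)"
      using C(1) by (intro compact_continuous_image linear_continuous_on blinfun.bounded_linear_right)
  qed (use C in auto)
qed

lemma compact_ops_compose_right:
  assumes A: "A \<in> bounded_ops" and T: "T \<in> compact_ops"
  shows "T o\<^sub>L A \<in> compact_ops"
proof -
  obtain C where C: "compact C" "\<And>x. norm x \<le> 1 \<Longrightarrow> blinfun_apply T x \<in> C"
    using compact_opsE[OF T] by blast
  define r where "r = norm A + 1"
  have r: "r > 0" by (simp add: r_def add_nonneg_pos)
  show ?thesis
  proof (rule compact_opsI)
    show "T o\<^sub>L A \<in> bounded_ops" by (rule bounded_ops_compose[OF compact_ops_bounded[OF T] A])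
    show "compact ((\<lambda>x. r *\<^sub>R x) ` C)" using C(1) by (rule compact_scaling)
    show "blinfun_apply (T o\<^sub>L A) ` cball 0 1 \<subseteq> (\<lambda>x. r *\<^sub>R x) ` C"
    proof clarsimp
      fix x :: 'a assume "norm x \<le> 1"
      then have "norm (blinfun_apply A x) \<le> norm A"
        using norm_blinfun[of A x] mult_left_le[of "norm x" "norm A"] by simp
      then have "norm (inverse r *\<^sub>R blinfun_apply A x) \<le> 1"
        using r by (simp add: r_def field_simps)
      then have "blinfun_apply T (inverse r *\<^sub>R blinfun_apply A x) \<in> C" by (rule C(2))
      then show "blinfun_apply T (blinfun_apply A x) \<in> (\<lambda>x. r *\<^sub>R x) ` C"
        using r by (intro image_eqI[of _ _ "blinfun_apply T (inverse r *\<^sub>R blinfun_apply A x)"])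
          (auto simp: blinfun.scaleR_right)
    qed
  qed
qed

lemma rank_one_bounded_ops: "rank_one x y \<in> bounded_ops"
  by (simp add: bounded_ops_def cinner_scaleC_left scaleC_scaleC)

lemma rank_one_compact: "rank_one x y \<in> compact_ops"
proof (rule compact_opsI[OF rank_one_bounded_ops])
  have "bounded_linear (\<lambda>c. c *\<^sub>C x)"
    by (rule bounded_linear_intro[where K = "norm x"])
      (auto simp: scaleC_add_left scaleR_scaleC scaleC_scaleC norm_scaleC scaleR_conv_of_real)
  then show "compact ((\<lambda>c. c *\<^sub>C x) ` cball 0 (norm y))"
    by (intro compact_continuous_image linear_continuous_on compact_cball)
  show "blinfun_apply (rank_one x y) ` cball 0 1 \<subseteq> (\<lambda>c. c *\<^sub>C x) ` cball 0 (norm y)"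
  proof clarsimp
    fix h :: 'a assume "norm h \<le> 1"
    then have "norm h * norm y \<le> norm y" by (simp add: mult_left_le_one_le)
    then have "cmod (cinner h y) \<le> norm y" using cinner_Cauchy_Schwarz order_trans by blast
    then show "cinner h y *\<^sub>C x \<in> (\<lambda>c. c *\<^sub>C x) ` cball 0 (norm y)" by auto
  qed
qed

lemma proj_compact: "proj E \<in> compact_ops"
  unfolding proj_def by (intro op_subspace_sum[OF op_subspace_compact_ops] rank_one_compact)

lemma proj_bounded_ops: "proj E \<in> bounded_ops"
  by (intro compact_ops_bounded proj_compact)

lemma norm_blinfun_le_unit:
  fixes T :: "'a::real_normed_vector \<Rightarrow>\<^sub>L 'b::real_normed_vector"
  assumes "e \<ge> 0" "\<And>x. norm x \<le> 1 \<Longrightarrow> norm (blinfun_apply T x) \<le> e"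
  shows "norm T \<le> e"
proof (rule norm_blinfun_bound[OF assms(1)])
  fix x :: 'a
  show "norm (blinfun_apply T x) \<le> e * norm x"
  proof (cases "x = 0")
    case False
    have "norm (blinfun_apply T (inverse (norm x) *\<^sub>R x)) \<le> e"
      using False by (intro assms(2)) simp
    then show ?thesis using False by (simp add: blinfun.scaleR_right field_simps)
  qed simp
qed

text \<open>The image of the unit ball under \<open>T\<close> lies within \<open>e\<close> of a relatively compact set for every
  \<open>e\<close>, hence is totally bounded.\<close>

lemma compact_ops_norm_limit:
  assumes T: "T \<in> bounded_ops"
    and approx: "\<And>e. e > 0 \<Longrightarrow> \<exists>R\<in>compact_ops. norm (T - R) \<le> e"
  shows "T \<in> compact_ops"
proof -
  let ?S = "closure (blinfun_apply T ` cball 0 1)"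
  have "\<exists>k. finite k \<and> ?S \<subseteq> (\<Union>x\<in>k. ball x e)" if e: "e > 0" for e
  proof -
    obtain R where R: "R \<in> compact_ops" "norm (T - R) \<le> e / 4" using approx[of "e/4"] e by auto
    obtain C where C: "compact C" "\<And>x. norm x \<le> 1 \<Longrightarrow> blinfun_apply R x \<in> C"
      using compact_opsE[OF R(1)] by blast
    obtain k where k: "finite k" "C \<subseteq> (\<Union>x\<in>k. ball x (e/4))"
      using C(1) e unfolding compact_eq_totally_bounded by (meson divide_pos_pos zero_less_numeral)
    have "blinfun_apply T ` cball 0 1 \<subseteq> (\<Union>x\<in>k. cball x (e/2))"
    proof clarsimp
      fix x :: 'a assume x: "norm x \<le> 1"
      obtain z where z: "z \<in> k" "dist z (blinfun_apply R x) < e/4" using k C(2)[OF x] by auto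
      have "norm (blinfun_apply (T - R) x) \<le> norm (T - R) * norm x" by (rule norm_blinfun)
      also have "\<dots> \<le> norm (T - R)" using x by (simp add: mult_left_le)
      finally have "dist (blinfun_apply R x) (blinfun_apply T x) \<le> e/4"
        using R(2) by (simp add: dist_norm norm_minus_commute blinfun.diff_left)
      then have "dist z (blinfun_apply T x) \<le> e/2"
        using z dist_triangle[of z "blinfun_apply T x" "blinfun_apply R x"] by simp
      then show "\<exists>z\<in>k. dist z (blinfun_apply T x) * 2 \<le> e" using z by (intro bexI[of _ z]) auto
    qed
    moreover have "closed (\<Union>x\<in>k. cball x (e/2))" using k by (intro closed_UN) auto
    ultimately have "?S \<subseteq> (\<Union>x\<in>k. cball x (e/2))" by (rule closure_minimal)
    also have "\<dots> \<subseteq> (\<Union>x\<in>k. ball x e)" using e by force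
    finally show ?thesis using k by blast
  qed
  then have "compact ?S"
    unfolding compact_eq_totally_bounded by (auto simp: complete_eq_closed)
  then show ?thesis using T by (simp add: compact_ops_def)
qed

text \<open>Take a finite \<open>e\<close>-net of the image of the unit ball and project onto its span:
  on the net, the complementary projection vanishes.\<close>

lemma compact_op_approx_proj:
  assumes T: "T \<in> compact_ops" and e: "e > 0"
  shows "\<exists>E. orthonormal E \<and> norm (T - (proj E o\<^sub>L T)) \<le> e"
proof -
  obtain C where C: "compact C" "\<And>x. norm x \<le> 1 \<Longrightarrow> blinfun_apply T x \<in> C"
    using compact_opsE[OF T] by blast
  obtain k where k: "finite k" "C \<subseteq> (\<Union>x\<in>k. ball x e)"
    using C(1) e unfolding compact_eq_totally_bounded by blast
  obtain E where E: "orthonormal E" "\<And>x. x \<in> k \<Longrightarrow> blinfun_apply (proj E) x = x"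
    using proj_fixing_finite_set[OF k(1)] by blast
  have "norm (T - (proj E o\<^sub>L T)) \<le> e"
  proof (rule norm_blinfun_le_unit)
    fix x :: 'a assume x: "norm x \<le> 1"
    obtain z where z: "z \<in> k" "dist z (blinfun_apply T x) < e" using k C(2)[OF x] by auto
    let ?d = "blinfun_apply T x - z"
    have "blinfun_apply (T - (proj E o\<^sub>L T)) x = ?d - blinfun_apply (proj E) ?d"
      using E(2)[OF z(1)] by (simp add: blinfun.diff_left blinfun.diff_right)
    also have "norm \<dots> \<le> norm ?d" by (rule norm_proj_apply_le(2)[OF E(1)])
    also have "\<dots> \<le> e" using z(2) by (simp add: dist_norm norm_minus_commute)
    finally show "norm (blinfun_apply (T - (proj E o\<^sub>L T)) x) \<le> e" .
  qed (use e in simp)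
  then show ?thesis using E(1) by blast
qed

text \<open>A maximising sequence has convergent images along a subsequence, and the parallelogram
  law turns this into convergence of the subsequence itself.\<close>

lemma compact_op_norm_attained:
  assumes R: "R \<in> compact_ops" and ne: "R \<noteq> 0"
  shows "\<exists>e. norm e = 1 \<and> norm (blinfun_apply R e) = norm R"
proof -
  define s where "s = norm R"
  have s: "s > 0" using ne by (simp add: s_def)
  have bound: "norm (blinfun_apply R x) \<le> s * norm x" for x
    unfolding s_def by (rule norm_blinfun)
  have "\<exists>x. norm x \<le> 1 \<and> norm (blinfun_apply R x) > s - inverse (real (Suc n)) * s" for n
  proof (rule ccontr)
    assume "\<not> ?thesis"
    then have "norm R \<le> s - inverse (real (Suc n)) * s"
      using s by (intro norm_blinfun_le_unit) (auto simp: not_less field_simps)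
    moreover have "inverse (real (Suc n)) * s > 0" using s by simp
    ultimately show False unfolding s_def by linarith
  qed
  then obtain x where x: "\<And>n. norm (x n) \<le> 1"
    "\<And>n. norm (blinfun_apply R (x n)) > s - inverse (real (Suc n)) * s" by metis
  obtain C where C: "compact C" "\<And>x. norm x \<le> 1 \<Longrightarrow> blinfun_apply R x \<in> C"
    using compact_opsE[OF R] by blast
  obtain z r where r: "strict_mono (r :: nat \<Rightarrow> nat)" and z: "(\<lambda>n. blinfun_apply R (x (r n))) \<longlonglongrightarrow> z"
    using seq_compactE[OF compact_imp_seq_compact[OF C(1)], of "\<lambda>n. blinfun_apply R (x n)"]
      C(2)[OF x(1)] unfolding o_def by blast
  have lim: "(\<lambda>n. norm (blinfun_apply R (x n))) \<longlonglongrightarrow> s"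
  proof (rule tendsto_sandwich)
    have "(\<lambda>n. s - inverse (real (Suc n)) * s) \<longlonglongrightarrow> s - 0 * s"
      by (intro tendsto_intros LIMSEQ_inverse_real_of_nat)
    then show "(\<lambda>n. s - inverse (real (Suc n)) * s) \<longlonglongrightarrow> s" by simp
    show "(\<lambda>_. s) \<longlonglongrightarrow> s" by simp
    show "\<forall>\<^sub>F n in sequentially. norm (blinfun_apply R (x n)) \<le> s"
      using bound[of "x _"] x(1) s by (intro always_eventually allI) (meson mult_left_le order_trans less_imp_le)
  qed (use x(2) in \<open>auto intro: less_imp_le always_eventually\<close>)
  have "(\<lambda>n. norm (blinfun_apply R (x (r n)))) \<longlonglongrightarrow> norm z" using z by (rule tendsto_norm)
  moreover have "(\<lambda>n. norm (blinfun_apply R (x (r n)))) \<longlonglongrightarrow> s"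
    using LIMSEQ_subseq_LIMSEQ[OF lim r] by (simp add: o_def)
  ultimately have nz: "norm z = s" by (rule LIMSEQ_unique)
  have "Cauchy (\<lambda>n. x (r n))"
  proof (rule metric_CauchyI)
    fix e :: real assume e: "e > 0"
    \<comment> \<open>images within \<open>d\<close> of \<open>z\<close> force \<open>\<parallel>x\<^sub>i - x\<^sub>j\<parallel>\<^sup>2 \<le> 8 d / s\<close>, which must stay below \<open>e\<^sup>2\<close>\<close>
    define d where "d = s * e\<^sup>2 / 9"
    have d: "d > 0" using s e by (simp add: d_def)
    obtain N where N: "\<And>n. n \<ge> N \<Longrightarrow> norm (blinfun_apply R (x (r n)) - z) < d"
      using LIMSEQ_D[OF z d] by blast
    have "dist (x (r i)) (x (r j)) < e" if ij: "i \<ge> N" "j \<ge> N" for i j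
    proof -
      let ?a = "x (r i)" and ?b = "x (r j)"
      have "2 * s = norm (z + z)" using nz by (simp flip: scaleR_2)
      also have "\<dots> = norm ((blinfun_apply R ?a + blinfun_apply R ?b)
          - ((blinfun_apply R ?a - z) + (blinfun_apply R ?b - z)))" by (simp add: algebra_simps)
      also have "\<dots> \<le> norm (blinfun_apply R (?a + ?b))
          + (norm (blinfun_apply R ?a - z) + norm (blinfun_apply R ?b - z))"
        unfolding blinfun.add_right by (intro norm_triangle_le_diff add_mono norm_triangle_ineq order_refl)
      also have "\<dots> < s * norm (?a + ?b) + (d + d)"
        using bound[of "?a + ?b"] N[OF ij(1)] N[OF ij(2)] by linarith
      finally have "s * (2 - norm (?a + ?b)) < s * (2 * e\<^sup>2 / 9)"
        by (simp add: d_def algebra_simps)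
      then have "2 - norm (?a + ?b) < 2 * e\<^sup>2 / 9" using s by simp
      moreover have "0 \<le> (norm (?a + ?b) - 2)\<^sup>2" by simp
      then have "4 * norm (?a + ?b) - 4 \<le> (norm (?a + ?b))\<^sup>2"
        by (simp add: power2_eq_square algebra_simps)
      moreover have "(norm ?a)\<^sup>2 \<le> 1" "(norm ?b)\<^sup>2 \<le> 1" using x(1) by (auto intro: power_le_one)
      ultimately have "(norm (?a - ?b))\<^sup>2 < e\<^sup>2"
        using parallelogram[of ?a ?b] e zero_less_power[OF e, of 2] by linarith
      then show ?thesis using e by (auto simp: dist_norm intro: power2_less_imp_less)
    qed
    then show "\<exists>M. \<forall>i\<ge>M. \<forall>j\<ge>M. dist (x (r i)) (x (r j)) < e" by blast
  qed
  then obtain y where y: "(\<lambda>n. x (r n)) \<longlonglongrightarrow> y"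
    using Cauchy_convergent convergent_def by metis
  have "(\<lambda>n. blinfun_apply R (x (r n))) \<longlonglongrightarrow> blinfun_apply R y"
    using y by (rule blinfun.tendsto[OF tendsto_const])
  then have "blinfun_apply R y = z" using z LIMSEQ_unique by blast
  then have Ry: "norm (blinfun_apply R y) = s" using nz by simp
  have "norm y \<le> 1" using LIMSEQ_le_const2[OF tendsto_norm[OF y]] x(1) by blast
  moreover have "norm y \<ge> 1" using bound[of y] Ry s by simp
  ultimately show ?thesis using Ry by (intro exI[of _ y]) (auto simp: s_def)
qed

section \<open>The trace class operator behind a functional\<close>

lemma rank_one_add_left: "rank_one (x + x') y = rank_one x y + rank_one x' y"
  by (rule blinfun_eqI) (simp add: blinfun.add_left scaleC_add_right)

lemma rank_one_scaleC_left: "rank_one (c *\<^sub>C x) y = op_scaleC c (rank_one x y)"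
  by (rule blinfun_eqI) (simp add: scaleC_scaleC mult.commute)

lemma rank_one_add_right: "rank_one x (y + y') = rank_one x y + rank_one x y'"
  by (rule blinfun_eqI) (simp add: blinfun.add_left cinner_add_right scaleC_add_left)

lemma rank_one_scaleC_right: "rank_one x (c *\<^sub>C y) = op_scaleC (cnj c) (rank_one x y)"
  by (rule blinfun_eqI) (simp add: cinner_scaleC_right scaleC_scaleC)

text \<open>For fixed \<open>x\<close>, the conjugate of \<open>\<psi> (rank_one x y)\<close> is linear in \<open>y\<close>, and its Riesz vector is
  the value of the operator at \<open>x\<close>.\<close>

lemma functional_operator:
  fixes \<psi> :: "'h::complex_hilbert_space op_functional"
  assumes \<psi>: "\<psi> \<in> dual bounded_ops"
  shows "\<exists>S\<in>bounded_ops. \<forall>x y. \<psi> (rank_one x y) = cinner (blinfun_apply S x) y"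
proof -
  define K where "K = dual_norm bounded_ops \<psi>"
  have K: "K \<ge> 0" unfolding K_def by (rule dual_norm_nonneg[OF op_subspace_bounded_ops \<psi>])
  have lin: "linear_functional bounded_ops \<psi>" using \<psi> by (simp add: dual_def)
  have add: "\<psi> (S + T) = \<psi> S + \<psi> T" if "S \<in> bounded_ops" "T \<in> bounded_ops" for S T
    using lin that by (simp add: linear_functional_def)
  have scale: "\<psi> (op_scaleC c T) = c * \<psi> T" if "T \<in> bounded_ops" for c T
    using lin that by (simp add: linear_functional_def)
  have bound: "cmod (\<psi> (rank_one x y)) \<le> K * (norm x * norm y)" for x y
  proof -
    have "cmod (\<psi> (rank_one x y)) \<le> K * norm (rank_one x y)"
      unfolding K_def by (rule dual_norm_bound[OF op_subspace_bounded_ops \<psi> rank_one_bounded_ops])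
    also have "\<dots> \<le> K * (norm x * norm y)" using K norm_rank_one_le by (rule mult_left_mono[rotated])
    finally show ?thesis .
  qed
  have "\<exists>w. \<forall>y. cnj (\<psi> (rank_one x y)) = cinner y w" for x
  proof (rule Riesz_representation)
    show "cmod (cnj (\<psi> (rank_one x y))) \<le> (K * norm x) * norm y" for y
      using bound[of x y] by (simp add: mult.assoc)
  qed (simp_all add: rank_one_add_right rank_one_scaleC_right add scale rank_one_bounded_ops)
  then obtain s where s: "\<And>x y. cnj (\<psi> (rank_one x y)) = cinner y (s x)" by metis
  have s': "\<psi> (rank_one x y) = cinner (s x) y" for x y
    using s[of x y] by (metis cinner_commute complex_cnj_cnj)
  have s_add: "s (x + y) = s x + s y" for x y
    by (rule cinner_eqI) (simp add: cinner_add_left rank_one_add_left add rank_one_bounded_ops flip: s')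
  have s_scale: "s (c *\<^sub>C x) = c *\<^sub>C s x" for c x
    by (rule cinner_eqI)
      (simp add: cinner_scaleC_left rank_one_scaleC_left scale rank_one_bounded_ops flip: s')
  have "bounded_linear s"
  proof (rule bounded_linear_intro[where K = K])
    fix x
    have "(norm (s x))\<^sup>2 = cmod (\<psi> (rank_one x (s x)))" unfolding s' cinner_same
      by (simp only: norm_of_real abs_power2 abs_norm_cancel power2_abs)
    also have "\<dots> \<le> K * (norm x * norm (s x))" by (rule bound)
    finally have le: "norm (s x) * norm (s x) \<le> (norm x * K) * norm (s x)"
      by (simp add: power2_eq_square mult.commute mult.left_commute)
    show "norm (s x) \<le> norm x * K"
    proof (cases "s x = 0")
      case False
      then show ?thesis using le by simp
    qed (use K in simp)
  qed (simp_all add: s_add s_scale scaleR_scaleC)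
  then have "blinfun_apply (Blinfun s) = s" by (rule bounded_linear_Blinfun_apply)
  then show ?thesis using s' s_scale by (intro bexI[of _ "Blinfun s"]) (auto simp: bounded_ops_def)
qed

lemma norm_sum_rank_one_le:
  assumes "finite I" "subnormal_family I e" "subnormal_family I f"
  shows "norm (\<Sum>i\<in>I. rank_one (e i) (f i)) \<le> 1"
proof (rule norm_blinfun_bound)
  fix h
  have "(norm (\<Sum>i\<in>I. cinner h (f i) *\<^sub>C e i))\<^sup>2 \<le> (norm h)\<^sup>2"
    by (rule order_trans[OF norm_sum_subnormal_le[OF assms(1,2)] Bessel[OF assms(1,3)]])
  then have "norm (\<Sum>i\<in>I. cinner h (f i) *\<^sub>C e i) \<le> norm h" by (rule power2_le_imp_le) simp
  then show "norm (blinfun_apply (\<Sum>i\<in>I. rank_one (e i) (f i)) h) \<le> 1 * norm h"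
    by (simp add: blinfun.sum_left)
qed simp

text \<open>The sum is the value of \<open>\<psi>\<close> at the contraction \<open>\<Sum> rank_one (e i) (f i)\<close>.  Bessel's
  inequality shows that it is one.\<close>

lemma trace_norm_bound:
  fixes \<psi> :: "'h::complex_hilbert_space op_functional"
  assumes \<psi>: "\<psi> \<in> dual bounded_ops"
    and S: "\<And>x y. \<psi> (rank_one x y) = cinner (blinfun_apply S x) y"
    and I: "finite I" "subnormal_family I e" "subnormal_family I f"
  shows "cmod (\<Sum>i\<in>I. cinner (blinfun_apply S (e i)) (f i)) \<le> dual_norm bounded_ops \<psi>"
proof -
  let ?A = "\<Sum>i\<in>I. rank_one (e i) (f i)"
  have "\<psi> ?A = (\<Sum>i\<in>I. cinner (blinfun_apply S (e i)) (f i))"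
    using \<psi> by (subst linear_functional_sum[OF op_subspace_bounded_ops])
      (auto simp: dual_def S rank_one_bounded_ops)
  moreover have "?A \<in> bounded_ops"
    by (intro op_subspace_sum[OF op_subspace_bounded_ops] rank_one_bounded_ops)
  then have "cmod (\<psi> ?A) \<le> dual_norm bounded_ops \<psi> * norm ?A"
    by (rule dual_norm_bound[OF op_subspace_bounded_ops \<psi>])
  moreover have "dual_norm bounded_ops \<psi> * norm ?A \<le> dual_norm bounded_ops \<psi>"
    using norm_sum_rank_one_le[OF I] dual_norm_nonneg[OF op_subspace_bounded_ops \<psi>]
    by (intro mult_left_le) auto
  ultimately show ?thesis by (metis order_trans)
qed

text \<open>If the form stayed large on every orthogonal complement of a finite set, one could pick
  orthonormal vectors one after the other and contradict the bound on the trace norm.\<close>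

lemma form_small_off_finite_set:
  fixes \<psi> :: "'h::complex_hilbert_space op_functional"
  assumes \<psi>: "\<psi> \<in> dual bounded_ops"
    and S: "\<And>x y. \<psi> (rank_one x y) = cinner (blinfun_apply S x) y"
    and SB: "S \<in> bounded_ops" and e: "\<epsilon> > 0"
  shows "\<exists>F. finite F \<and> (\<forall>x y. (\<forall>z\<in>F. cinner x z = 0 \<and> cinner y z = 0) \<longrightarrow>
    cmod (cinner (blinfun_apply S x) y) \<le> \<epsilon> * (norm x * norm y))"
proof (rule ccontr)
  assume neg: "\<not> ?thesis"
  have big: "\<exists>x y. (\<forall>z\<in>F. cinner x z = 0 \<and> cinner y z = 0) \<and> norm x = 1 \<and> norm y = 1
      \<and> \<epsilon> < Re (cinner (blinfun_apply S x) y)" if "finite F" for F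
  proof -
    have "\<exists>x y. (\<forall>z\<in>F. cinner x z = 0 \<and> cinner y z = 0) \<and>
        \<epsilon> * (norm x * norm y) < cmod (cinner (blinfun_apply S x) y)"
    proof (rule ccontr)
      assume n: "\<not> ?thesis"
      have "\<forall>x y. (\<forall>z\<in>F. cinner x z = 0 \<and> cinner y z = 0) \<longrightarrow>
          cmod (cinner (blinfun_apply S x) y) \<le> \<epsilon> * (norm x * norm y)"
      proof (intro allI impI)
        fix x y assume "\<forall>z\<in>F. cinner x z = 0 \<and> cinner y z = 0"
        with n show "cmod (cinner (blinfun_apply S x) y) \<le> \<epsilon> * (norm x * norm y)"
          by (metis not_le)
      qed
      then show False using neg that by iprover
    qed
    then obtain x y where xy: "\<forall>z\<in>F. cinner x z = 0 \<and> cinner y z = 0"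
      "\<epsilon> * (norm x * norm y) < cmod (cinner (blinfun_apply S x) y)"
      by blast
    have ne: "x \<noteq> 0" "y \<noteq> 0" using xy(2) by auto
    obtain c where c: "cmod c = 1"
      "c * cinner (blinfun_apply S x) y = complex_of_real (cmod (cinner (blinfun_apply S x) y))"
      using phase_exists by blast
    define u where "u = inverse (norm x) *\<^sub>R (c *\<^sub>C x)"
    define v where "v = inverse (norm y) *\<^sub>R y"
    have "cinner (blinfun_apply S u) v = (inverse (norm x) * inverse (norm y)) *
        complex_of_real (cmod (cinner (blinfun_apply S x) y))"
      unfolding c(2)[symmetric] u_def v_def
      by (simp add: blinfun.scaleR_right bounded_opsD[OF SB] cinner_simps)
    then have "Re (cinner (blinfun_apply S u) v)
        = cmod (cinner (blinfun_apply S x) y) / (norm x * norm y)"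
      by (simp add: field_simps)
    also have "\<dots> > \<epsilon>" using xy(2) ne by (simp add: pos_less_divide_eq)
    finally have "\<epsilon> < Re (cinner (blinfun_apply S u) v)" .
    moreover have "norm u = 1" "norm v = 1" using ne c by (auto simp: u_def v_def norm_scaleC)
    moreover have "\<forall>z\<in>F. cinner u z = 0 \<and> cinner v z = 0"
      using xy(1) by (simp add: u_def v_def cinner_simps)
    ultimately show ?thesis by blast
  qed
  have fam: "\<exists>e f. subnormal_family {..<n} e \<and> subnormal_family {..<n} f \<and>
      (\<forall>i<n. \<epsilon> < Re (cinner (blinfun_apply S (e i)) (f i)))" for n :: nat
  proof (induction n)
    case 0
    then show ?case by (simp add: subnormal_family_def)
  next
    case (Suc n)
    then obtain e f where ef: "subnormal_family {..<n} e" "subnormal_family {..<n} f"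
      "\<forall>i<n. \<epsilon> < Re (cinner (blinfun_apply S (e i)) (f i))" by blast
    have "finite (e ` {..<n} \<union> f ` {..<n})" by simp
    from big[OF this] obtain x y where xy: "\<forall>z\<in>e ` {..<n} \<union> f ` {..<n}. cinner x z = 0 \<and> cinner y z = 0"
      "norm x = 1" "norm y = 1" "\<epsilon> < Re (cinner (blinfun_apply S x) y)"
      by blast
    have ext: "subnormal_family {..<Suc n} (g(n := u))"
      if g: "subnormal_family {..<n} g" and u: "norm u = 1" "\<forall>i<n. cinner u (g i) = 0" for g u
    proof -
      have "\<forall>i<n. cinner (g i) u = 0" using u(2) cinner_eq_0_commute by blast
      then show ?thesis using g u by (auto simp: subnormal_family_def lessThan_Suc)
    qed
    have "subnormal_family {..<Suc n} (e(n := x))" "subnormal_family {..<Suc n} (f(n := y))"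
      by (rule ext[OF ef(1) xy(2)], use xy(1) in simp)
        (rule ext[OF ef(2) xy(3)], use xy(1) in simp)
    moreover have "\<forall>i<Suc n. \<epsilon> < Re (cinner (blinfun_apply S ((e(n := x)) i)) ((f(n := y)) i))"
      using ef(3) xy(4) by (simp add: less_Suc_eq)
    ultimately show ?case by blast
  qed
  let ?K = "dual_norm bounded_ops \<psi>"
  obtain n where n: "real n * \<epsilon> > ?K" using e reals_Archimedean3 by blast
  obtain e f where ef: "subnormal_family {..<n} e" "subnormal_family {..<n} f"
    "\<forall>i<n. \<epsilon> < Re (cinner (blinfun_apply S (e i)) (f i))" using fam by blast
  have "real n * \<epsilon> = (\<Sum>i<n. \<epsilon>)" by simp
  also have "\<dots> \<le> (\<Sum>i<n. Re (cinner (blinfun_apply S (e i)) (f i)))"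
    using ef(3) by (intro sum_mono) (auto intro: less_imp_le)
  also have "\<dots> = Re (\<Sum>i<n. cinner (blinfun_apply S (e i)) (f i))" by simp
  also have "\<dots> \<le> ?K"
    by (rule order_trans[OF complex_Re_le_cmod trace_norm_bound[OF \<psi> S _ ef(1,2)]]) simp
  finally show False using n by simp
qed

text \<open>With \<open>P\<close> the projection onto the span of a finite set off which the form of \<open>S\<close> is small, all
  of \<open>S\<close> except the corner \<open>(1 - P) S (1 - P)\<close> has finite rank, and that corner is small in norm.\<close>

lemma functional_operator_compact:
  fixes \<psi> :: "'h::complex_hilbert_space op_functional"
  assumes \<psi>: "\<psi> \<in> dual bounded_ops"
    and S: "\<And>x y. \<psi> (rank_one x y) = cinner (blinfun_apply S x) y"
    and SB: "S \<in> bounded_ops"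
  shows "S \<in> compact_ops"
proof (rule compact_ops_norm_limit[OF SB])
  fix \<epsilon> :: real assume e: "\<epsilon> > 0"
  obtain F where F: "finite F" "\<And>x y. (\<forall>z\<in>F. cinner x z = 0 \<and> cinner y z = 0) \<Longrightarrow>
      cmod (cinner (blinfun_apply S x) y) \<le> \<epsilon> * (norm x * norm y)"
    using form_small_off_finite_set[OF \<psi> S SB e] by blast
  obtain E where E: "orthonormal E" "\<forall>x\<in>F. blinfun_apply (proj E) x = x"
    using proj_fixing_finite_set[OF F(1)] by blast
  let ?P = "proj E"
  \<comment> \<open>\<open>S - R = (1 - P) S (1 - P)\<close>\<close>
  define R where "R = (?P o\<^sub>L S) + (S o\<^sub>L ?P) - (?P o\<^sub>L (S o\<^sub>L ?P))"
  have PS: "?P o\<^sub>L S \<in> compact_ops" and SP: "S o\<^sub>L ?P \<in> compact_ops"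
    by (rule compact_ops_compose_right[OF SB proj_compact],
        rule compact_ops_compose_left[OF SB proj_compact])
  have "?P o\<^sub>L (S o\<^sub>L ?P) \<in> compact_ops" by (rule compact_ops_compose_left[OF proj_bounded_ops SP])
  moreover have "(?P o\<^sub>L S) + (S o\<^sub>L ?P) \<in> compact_ops"
    using PS SP op_subspace_compact_ops unfolding op_subspace_def by blast
  ultimately have "R \<in> compact_ops"
    unfolding R_def by (intro op_subspace_diff[OF op_subspace_compact_ops])
  moreover have "norm (S - R) \<le> \<epsilon>"
  proof (rule norm_blinfun_bound)
    fix h
    define u where "u = h - blinfun_apply ?P h"
    define v where "v = blinfun_apply S u - blinfun_apply ?P (blinfun_apply S u)"
    have off: "cinner (k - blinfun_apply ?P k) z = 0" if "z \<in> F" for k z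
      using that E(2) by (simp add: cinner_diff_left cinner_proj_left)
    have "blinfun_apply (S - R) h = v"
      by (simp add: R_def u_def v_def blinfun.diff_left blinfun.diff_right blinfun.add_left)
    moreover have "norm v \<le> \<epsilon> * norm h"
    proof -
      have "cinner (blinfun_apply ?P (blinfun_apply S u)) v = 0"
        unfolding v_def by (rule proj_orth[OF E(1)])
      then have "cinner (blinfun_apply S u) v = cinner v v"
        by (metis cinner_add_left diff_add_cancel add.right_neutral v_def)
      then have "(norm v)\<^sup>2 = cmod (cinner (blinfun_apply S u) v)"
        by (simp add: cinner_same norm_power)
      also have "\<dots> \<le> \<epsilon> * (norm u * norm v)"
        by (rule F(2)) (auto simp: u_def v_def off)
      also have "\<dots> \<le> \<epsilon> * (norm h * norm v)"
        using e norm_proj_apply_le(2)[OF E(1), of h]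
        by (intro mult_left_mono mult_right_mono) (auto simp: u_def)
      finally have le: "norm v * norm v \<le> (\<epsilon> * norm h) * norm v"
        by (simp add: power2_eq_square mult.assoc)
      show ?thesis
      proof (cases "v = 0")
        case False
        then show ?thesis using le by simp
      qed (use e in simp)
    qed
    ultimately show "norm (blinfun_apply (S - R) h) \<le> \<epsilon> * norm h" by simp
  qed (use e in simp)
  ultimately show "\<exists>R\<in>compact_ops. norm (S - R) \<le> \<epsilon>" by blast
qed

subsection \<open>Singular value decomposition by deflation\<close>

text \<open>The value \<open>0\<close> at \<open>R = 0\<close> makes deflation stationary once nothing is left, so that operators of
  finite rank need no separate treatment.\<close>

definition maximizer :: "('h::complex_hilbert_space \<Rightarrow>\<^sub>L 'h) \<Rightarrow> 'h" where
  "maximizer R = (if R = 0 then 0 else SOME e. norm e = 1 \<and> norm (blinfun_apply R e) = norm R)"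

text \<open>One step of the singular value decomposition: \<open>R (1 - e \<otimes> e\<^sup>*)\<close> for the maximiser \<open>e\<close>.\<close>

definition deflate :: "('h::complex_hilbert_space \<Rightarrow>\<^sub>L 'h) \<Rightarrow> ('h \<Rightarrow>\<^sub>L 'h)" where
  "deflate R = R - rank_one (blinfun_apply R (maximizer R)) (maximizer R)"

lemma maximizer_norm:
  assumes "R \<in> compact_ops"
  shows "norm (blinfun_apply R (maximizer R)) = norm R"
    and "R \<noteq> 0 \<Longrightarrow> norm (maximizer R) = 1" and "norm (maximizer R) \<le> 1"
  using someI_ex[OF compact_op_norm_attained[OF assms]] by (auto simp: maximizer_def)

lemma deflate_apply:
  assumes "R \<in> bounded_ops"
  shows "blinfun_apply (deflate R) h = blinfun_apply R (h - cinner h (maximizer R) *\<^sub>C maximizer R)"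
  by (simp add: deflate_def blinfun.diff_left blinfun.diff_right bounded_opsD[OF assms])

lemma deflate_compact: "R \<in> compact_ops \<Longrightarrow> deflate R \<in> compact_ops"
  unfolding deflate_def by (intro op_subspace_diff[OF op_subspace_compact_ops] rank_one_compact)

lemma deflate_maximizer:
  assumes "R \<in> compact_ops"
  shows "blinfun_apply (deflate R) (maximizer R) = 0"
proof (cases "R = 0")
  case True
  then show ?thesis by (simp add: deflate_def maximizer_def)
next
  case False
  then have "cinner (maximizer R) (maximizer R) = 1"
    using maximizer_norm(2)[OF assms] by (simp add: cinner_same)
  then show ?thesis
    by (simp add: deflate_apply[OF compact_ops_bounded[OF assms]] scaleC_one)
qed

text \<open>The first variation of \<open>\<parallel>R x\<parallel>\<^sup>2 / \<parallel>x\<parallel>\<^sup>2\<close> vanishes at the maximiser, so \<open>R\<close> maps the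
  complement of the maximiser into the complement of its image.\<close>

lemma norm_attaining_orthogonal:
  assumes R: "R \<in> bounded_ops" and e: "norm e = 1" "norm (blinfun_apply R e) = norm R"
    and v: "cinner e v = 0"
  shows "cinner (blinfun_apply R v) (blinfun_apply R e) = 0"
proof -
  define a where "a = cinner (blinfun_apply R v) (blinfun_apply R e)"
  define B where "B = (norm R)\<^sup>2 * (norm v)\<^sup>2"
  have B: "B \<ge> 0" by (simp add: B_def)
  have var: "2 * t * (cmod a)\<^sup>2 \<le> t\<^sup>2 * (cmod a)\<^sup>2 * B" for t :: real
  proof -
    \<comment> \<open>the phase of \<open>a\<close> is compensated, so that the first-order term becomes \<open>2 t \<bar>a\<bar>\<^sup>2\<close>\<close>
    let ?c = "complex_of_real t * cnj a"
    have "cinner (blinfun_apply R e) (?c *\<^sub>C blinfun_apply R v) = complex_of_real t * (a * cnj a)"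
      unfolding cinner_scaleC_right using cinner_commute[of "blinfun_apply R e" "blinfun_apply R v"]
      by (simp add: a_def)
    also have "\<dots> = complex_of_real (t * (cmod a)\<^sup>2)" by (simp only: complex_norm_square of_real_mult)
    finally have re: "Re (cinner (blinfun_apply R e) (?c *\<^sub>C blinfun_apply R v)) = t * (cmod a)\<^sup>2"
      by (simp only: Re_complex_of_real)
    have "norm (blinfun_apply R (e + ?c *\<^sub>C v)) \<le> norm R * norm (e + ?c *\<^sub>C v)" by (rule norm_blinfun)
    then have "(norm (blinfun_apply R (e + ?c *\<^sub>C v)))\<^sup>2 \<le> (norm R)\<^sup>2 * (norm (e + ?c *\<^sub>C v))\<^sup>2"
      by (metis norm_ge_zero power_mono power_mult_distrib)
    also have "(norm (e + ?c *\<^sub>C v))\<^sup>2 = 1 + (norm (?c *\<^sub>C v))\<^sup>2"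
      using v e by (simp add: pythagoras cinner_simps)
    finally have "(norm (blinfun_apply R e + ?c *\<^sub>C blinfun_apply R v))\<^sup>2
        \<le> (norm R)\<^sup>2 * (1 + (norm (?c *\<^sub>C v))\<^sup>2)"
      by (simp add: blinfun.add_right bounded_opsD[OF R])
    then have "(norm R)\<^sup>2 + 2 * (t * (cmod a)\<^sup>2) \<le> (norm R)\<^sup>2 * (1 + (norm (?c *\<^sub>C v))\<^sup>2)"
      unfolding norm_add_sq re e(2) using zero_le_power2[of "norm (?c *\<^sub>C blinfun_apply R v)"] by linarith
    moreover have "(norm (?c *\<^sub>C v))\<^sup>2 = t\<^sup>2 * (cmod a)\<^sup>2 * (norm v)\<^sup>2"
      by (simp add: norm_scaleC norm_mult power_mult_distrib)
    ultimately show ?thesis by (simp add: B_def algebra_simps)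
  qed
  have "cmod a = 0"
  proof (rule ccontr)
    assume "cmod a \<noteq> 0"
    then have "2 * t \<le> t * (t * B)" for t
      using var[of t] mult_le_cancel_left_pos[of "(cmod a)\<^sup>2" "2 * t" "t * (t * B)"]
      by (simp add: power2_eq_square mult.commute mult.left_commute)
    \<comment> \<open>any \<open>t > 0\<close> with \<open>t B < 2\<close> would do\<close>
    from this[of "1 / (B + 1)"] show False using B by (simp add: divide_simps)
  qed
  then show ?thesis by (simp add: a_def)
qed

lemma deflate_orthogonal:
  assumes R: "R \<in> compact_ops"
  shows "cinner (blinfun_apply (deflate R) h) (blinfun_apply R (maximizer R)) = 0"
proof (cases "R = 0")
  case False
  let ?e = "maximizer R"
  have ee: "cinner ?e ?e = 1" using maximizer_norm(2)[OF R False] by (simp add: cinner_same)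
  have "cinner (h - cinner h ?e *\<^sub>C ?e) ?e = 0" by (simp add: cinner_simps ee)
  then have "cinner ?e (h - cinner h ?e *\<^sub>C ?e) = 0" using cinner_eq_0_commute by blast
  then show ?thesis
    unfolding deflate_apply[OF compact_ops_bounded[OF R]]
    using maximizer_norm[OF R] False compact_ops_bounded[OF R]
    by (intro norm_attaining_orthogonal) auto
qed simp

text \<open>Removing from the maximiser its component along \<open>k\<close> does not change its image; if that
  component were nonzero, a vector shorter than 1 would attain the norm.\<close>

lemma maximizer_orthogonal_kernel:
  assumes R: "R \<in> compact_ops" and k: "blinfun_apply R k = 0"
  shows "cinner k (maximizer R) = 0"
proof (cases "R = 0 \<or> k = 0")
  case False
  let ?e = "maximizer R"
  define c where "c = cinner ?e k / complex_of_real ((norm k)\<^sup>2)"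
  define v where "v = ?e - c *\<^sub>C k"
  have "cinner v k = 0" using False by (simp add: v_def c_def cinner_simps cinner_same)
  then have vk: "cinner v (c *\<^sub>C k) = 0" by (simp add: cinner_simps)
  have "norm R = norm (blinfun_apply R v)"
    using maximizer_norm(1)[OF R] k by (simp add: v_def blinfun.diff_right bounded_opsD[OF compact_ops_bounded[OF R]])
  also have "\<dots> \<le> norm R * norm v" by (rule norm_blinfun)
  finally have "1 \<le> norm v" using False by simp
  then have "1 \<le> (norm v)\<^sup>2" by (rule one_le_power)
  moreover have "(norm ?e)\<^sup>2 = (norm v)\<^sup>2 + (norm (c *\<^sub>C k))\<^sup>2"
    using pythagoras[OF vk] by (simp add: v_def)
  moreover have "(norm ?e)\<^sup>2 = 1" using maximizer_norm(2)[OF R] False by simp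
  ultimately have "(norm (c *\<^sub>C k))\<^sup>2 \<le> 0" by linarith
  then have "c = 0" using False by (simp add: norm_scaleC)
  then have "cinner ?e k = 0" using False by (simp add: c_def)
  then show ?thesis using cinner_eq_0_commute by blast
qed (auto simp: maximizer_def)

text \<open>Iterated deflation.  The remainder \<open>R n\<close> kills the earlier maximisers and has range orthogonal to
  the earlier images, which yields both orthogonality relations.  The
  remainder has norm \<open>norm (g n)\<close>, so the expansion converges once these norms are summable.\<close>

lemma singular_value_decomposition:
  fixes S :: "'h::complex_hilbert_space \<Rightarrow>\<^sub>L 'h"
  assumes S: "S \<in> compact_ops"
  shows "\<exists>e g R. subnormal_family (UNIV :: nat set) e \<and>
    (\<forall>i j. i \<noteq> j \<longrightarrow> cinner (g i) (g j) = 0) \<and>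
    (\<forall>n. blinfun_apply S (e n) = g n \<and> norm (R n) = norm (g n) \<and>
      S = (\<Sum>i<n. rank_one (g i) (e i)) + R n)"
proof -
  define R where "R n = (deflate ^^ n) S" for n
  define e where "e n = maximizer (R n)" for n
  define g where "g n = blinfun_apply (R n) (e n)" for n
  have RS: "R (Suc n) = deflate (R n)" for n by (simp add: R_def)
  have Rc: "R n \<in> compact_ops" for n
    by (induction n) (simp_all add: R_def S deflate_compact)
  have split: "S = (\<Sum>i<n. rank_one (g i) (e i)) + R n" for n
  proof (induction n)
    case (Suc n)
    then show ?case unfolding RS deflate_def by (simp add: g_def e_def)
  qed (simp add: R_def)
  have kill: "blinfun_apply (R m) (e n) = 0" if "n < m" for n m
    using that
  proof (induction m)
    case (Suc m)
    show ?case
    proof (cases "n = m")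
      case True
      then show ?thesis unfolding RS e_def using deflate_maximizer[OF Rc] by simp
    next
      case False
      then have k: "blinfun_apply (R m) (e n) = 0" using Suc by simp
      then show ?thesis
        unfolding RS deflate_apply[OF compact_ops_bounded[OF Rc]]
        using maximizer_orthogonal_kernel[OF Rc k] by simp
    qed
  qed simp
  have orth: "cinner (blinfun_apply (R m) h) (g n) = 0" if "n < m" for n m h
    using that
  proof (induction m arbitrary: h)
    case (Suc m)
    show ?case
    proof (cases "n = m")
      case True
      then show ?thesis unfolding RS g_def e_def using deflate_orthogonal[OF Rc] by simp
    next
      case False
      then show ?thesis unfolding RS deflate_apply[OF compact_ops_bounded[OF Rc]] using Suc by simp
    qed
  qed simp
  have ee: "cinner (e i) (e j) = 0" if "i \<noteq> j" for i j
  proof -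
    have lt: "cinner (e i) (e j) = 0" if "i < j" for i j
      using maximizer_orthogonal_kernel[OF Rc kill[OF that]] by (simp add: e_def)
    show ?thesis using lt[of i j] lt[of j i] that
      by (metis cinner_eq_0_commute linorder_neqE_nat)
  qed
  have gg: "cinner (g i) (g j) = 0" if "i \<noteq> j" for i j
  proof -
    have lt: "cinner (g j) (g i) = 0" if "i < j" for i j
      unfolding g_def[of j] by (rule orth[OF that])
    show ?thesis using lt[of i j] lt[of j i] that
      by (metis cinner_eq_0_commute linorder_neqE_nat)
  qed
  have Se: "blinfun_apply S (e n) = g n" for n
  proof -
    have "blinfun_apply S (e n) = (\<Sum>i<n. cinner (e n) (e i) *\<^sub>C g i) + g n"
      by (subst split[of n]) (simp add: blinfun.add_left blinfun.sum_left g_def)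
    also have "(\<Sum>i<n. cinner (e n) (e i) *\<^sub>C g i) = 0" by (intro sum.neutral) (auto simp: ee)
    finally show ?thesis by simp
  qed
  have "subnormal_family UNIV e"
    using maximizer_norm(3)[OF Rc] ee by (auto simp: subnormal_family_def e_def)
  moreover have "norm (R n) = norm (g n)" for n
    unfolding g_def e_def using maximizer_norm(1)[OF Rc] by simp
  ultimately show ?thesis
    by (intro exI[of _ e] exI[of _ g] exI[of _ R] conjI allI impI gg Se split)
qed

text \<open>The trace bound, tested on the singular vectors, says that the singular values \<open>s n\<close> are summable.
  So the remainders in the decomposition of \<open>S\<close> vanish in the limit, and distributing \<open>sqrt (s n)\<close>
  evenly over the two singular vectors gives square-summable sequences.\<close>

theorem functional_trace_on_rank_one:
  fixes \<psi> :: "'h::complex_hilbert_space op_functional"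
  assumes \<psi>: "\<psi> \<in> dual bounded_ops"
  shows "\<exists>x y. summable (\<lambda>n. (norm (x n))\<^sup>2) \<and> summable (\<lambda>n. (norm (y n))\<^sup>2) \<and>
    (\<forall>u v. \<psi> (rank_one u v) = trace_functional x y (rank_one u v))"
proof -
  obtain S where SB: "S \<in> bounded_ops" and S: "\<And>x y. \<psi> (rank_one x y) = cinner (blinfun_apply S x) y"
    using functional_operator[OF \<psi>] by blast
  have Sc: "S \<in> compact_ops" by (rule functional_operator_compact[OF \<psi> S SB])
  obtain e g R where svd: "subnormal_family (UNIV :: nat set) e \<and>
      (\<forall>i j. i \<noteq> j \<longrightarrow> cinner (g i) (g j) = 0) \<and>
      (\<forall>n. blinfun_apply S (e n) = g n \<and> norm (R n) = norm (g n) \<and>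
        S = (\<Sum>i<n. rank_one (g i) (e i)) + R n)"
    using singular_value_decomposition[OF Sc] by (elim exE)
  have e: "subnormal_family UNIV e" and g: "\<And>i j. i \<noteq> j \<Longrightarrow> cinner (g i) (g j) = 0"
    by (rule svd[THEN conjunct1], rule svd[THEN conjunct2, THEN conjunct1, rule_format])
  note ker = svd[THEN conjunct2, THEN conjunct2, rule_format]
  have Se: "\<And>n. blinfun_apply S (e n) = g n" and R: "\<And>n. norm (R n) = norm (g n)"
    and split: "\<And>n. S = (\<Sum>i<n. rank_one (g i) (e i)) + R n"
    by (rule ker[THEN conjunct1], rule ker[THEN conjunct2, THEN conjunct1],
        rule ker[THEN conjunct2, THEN conjunct2])
  define s where "s n = norm (g n)" for n
  \<comment> \<open>\<open>f n = 0\<close> when \<open>s n = 0\<close>, which is why the families are only required to be subnormal\<close>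
  define f where "f n = inverse (s n) *\<^sub>R g n" for n
  have s: "s n \<ge> 0" for n by (simp add: s_def)
  have gf: "g n = s n *\<^sub>R f n" for n by (cases "g n = 0") (auto simp: f_def s_def)
  have nf: "norm (f n) \<le> 1" for n by (cases "g n = 0") (auto simp: f_def s_def)
  have ne: "norm (e n) \<le> 1" for n using e by (simp add: subnormal_family_def)
  have sgf: "cinner (g n) (f n) = complex_of_real (s n)" for n
    by (cases "g n = 0") (auto simp: f_def s_def cinner_simps cinner_same power2_eq_square)
  have sub: "subnormal_family {..<n} e" "subnormal_family {..<n} f" for n
    using e g nf by (auto simp: subnormal_family_def f_def cinner_simps)
  have "(\<Sum>i<n. s i) \<le> dual_norm bounded_ops \<psi>" for n
  proof -
    have "complex_of_real (\<Sum>i<n. s i) = (\<Sum>i<n. cinner (blinfun_apply S (e i)) (f i))"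
      by (simp add: Se sgf)
    then have "cmod (complex_of_real (\<Sum>i<n. s i)) \<le> dual_norm bounded_ops \<psi>"
      using trace_norm_bound[OF \<psi> S _ sub, of n] by simp
    then show ?thesis by (simp only: norm_of_real)
  qed
  then have summ: "summable s"
    using s by (intro summableI_nonneg_bounded)
  define x where "x n = sqrt (s n) *\<^sub>R f n" for n
  define y where "y n = sqrt (s n) *\<^sub>R e n" for n
  have sq: "(norm (sqrt (s n) *\<^sub>R h))\<^sup>2 \<le> s n" if "norm h \<le> 1" for n and h :: 'h
  proof -
    have "(norm h)\<^sup>2 \<le> 1" using that by (simp add: power_le_one)
    then show ?thesis using s[of n] by (simp add: power_mult_distrib mult_left_le)
  qed
  have "summable (\<lambda>n. (norm (x n))\<^sup>2)" "summable (\<lambda>n. (norm (y n))\<^sup>2)"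
    using sq[OF nf] sq[OF ne] by (auto simp: x_def y_def intro!: summable_comparison_test'[OF summ, of 0])
  moreover have "\<psi> (rank_one u v) = trace_functional x y (rank_one u v)" for u v
  proof -
    have term_eq: "cinner (blinfun_apply (rank_one u v) (x n)) (y n) = cinner u (e n) * cinner (g n) v" for n
    proof -
      have "complex_of_real (sqrt (s n)) * complex_of_real (sqrt (s n)) = complex_of_real (s n)"
        using s[of n] by (simp flip: of_real_mult)
      then show ?thesis
        unfolding gf[of n] by (simp add: x_def y_def cinner_simps mult.assoc mult.left_commute)
    qed
    have small: "norm (cinner (blinfun_apply (R n) u) v) \<le> s n * (norm u * norm v)" for n
    proof -
      have "cmod (cinner (blinfun_apply (R n) u) v) \<le> norm (blinfun_apply (R n) u) * norm v"
        by (rule cinner_Cauchy_Schwarz)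
      also have "\<dots> \<le> (norm (R n) * norm u) * norm v"
        by (intro mult_right_mono norm_blinfun) auto
      finally show ?thesis by (simp add: R s_def mult.assoc)
    qed
    have lim: "(\<lambda>n. s n * (norm u * norm v)) \<longlonglongrightarrow> 0"
      by (rule tendsto_mult_left_zero[OF summable_LIMSEQ_zero[OF summ]])
    have "(\<lambda>n. cinner (blinfun_apply (R n) u) v) \<longlonglongrightarrow> 0"
      by (rule Lim_null_comparison[OF always_eventually[OF allI[OF small]] lim])
    from tendsto_diff[OF tendsto_const this] have "(\<lambda>n. \<psi> (rank_one u v) - cinner (blinfun_apply (R n) u) v) \<longlonglongrightarrow> \<psi> (rank_one u v) - 0" .
    moreover have part: "\<psi> (rank_one u v) - cinner (blinfun_apply (R n) u) v
        = (\<Sum>i<n. cinner u (e i) * cinner (g i) v)" for n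
      unfolding S by (subst split[of n])
        (simp add: blinfun.add_left blinfun.sum_left cinner_add_left cinner_sum_left cinner_scaleC_left)
    ultimately have "(\<lambda>i. cinner u (e i) * cinner (g i) v) sums \<psi> (rank_one u v)"
      unfolding sums_def by (simp only: part diff_zero)
    then show ?thesis unfolding trace_functional_def term_eq by (rule sums_unique)
  qed
  ultimately show ?thesis by blast
qed

section \<open>Trace functionals and finite-dimensional compressions\<close>

lemma trace_term_le:
  "cmod (cinner (blinfun_apply T x) y) \<le> norm T * ((norm x)\<^sup>2 + (norm y)\<^sup>2)"
  for x :: "'h::complex_hilbert_space"
proof -
  have "cmod (cinner (blinfun_apply T x) y) \<le> norm (blinfun_apply T x) * norm y"
    by (rule cinner_Cauchy_Schwarz)
  also have "\<dots> \<le> (norm T * norm x) * norm y" by (intro mult_right_mono norm_blinfun) auto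
  also have "norm x * norm y \<le> (norm x)\<^sup>2 + (norm y)\<^sup>2"
  proof -
    have "2 * (norm x * norm y) \<le> (norm x)\<^sup>2 + (norm y)\<^sup>2"
      using sum_squares_bound[of "norm x" "norm y"] by (simp add: mult.assoc)
    moreover have "0 \<le> norm x * norm y" by simp
    ultimately show ?thesis by linarith
  qed
  then have "(norm T * norm x) * norm y \<le> norm T * ((norm x)\<^sup>2 + (norm y)\<^sup>2)"
    by (simp add: mult.assoc mult_left_mono)
  finally show ?thesis .
qed

context
  fixes x y :: "nat \<Rightarrow> 'h::complex_hilbert_space"
  assumes x: "summable (\<lambda>n. (norm (x n))\<^sup>2)" and y: "summable (\<lambda>n. (norm (y n))\<^sup>2)"
begin

lemma trace_bound_summable: "summable (\<lambda>n. c * ((norm (x n))\<^sup>2 + (norm (y n))\<^sup>2))"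
  by (intro summable_mult summable_add x y)

lemma trace_summable: "summable (\<lambda>n. cinner (blinfun_apply T (x n)) (y n))"
  by (rule summable_comparison_test'[OF trace_bound_summable[of "norm T"], of 0]) (rule trace_term_le)

lemma trace_functional_add:
  "trace_functional x y (S + T) = trace_functional x y S + trace_functional x y T"
  unfolding trace_functional_def
  by (simp add: blinfun.add_left cinner_add_left suminf_add trace_summable)

lemma trace_functional_scaleC:
  "trace_functional x y (op_scaleC c T) = c * trace_functional x y T"
  unfolding trace_functional_def
  by (simp add: cinner_scaleC_left suminf_mult trace_summable)

lemma trace_functional_bound:
  "cmod (trace_functional x y T) \<le> (\<Sum>n. (norm (x n))\<^sup>2 + (norm (y n))\<^sup>2) * norm T"
proof -
  have "cmod (trace_functional x y T) \<le> (\<Sum>n. norm T * ((norm (x n))\<^sup>2 + (norm (y n))\<^sup>2))"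
    unfolding trace_functional_def
    by (rule norm_suminf_le[OF trace_term_le trace_bound_summable])
  also have "\<dots> = norm T * (\<Sum>n. (norm (x n))\<^sup>2 + (norm (y n))\<^sup>2)"
    by (rule suminf_mult[OF summable_add[OF x y]])
  finally show ?thesis by (simp add: mult.commute)
qed

text \<open>Dominated convergence for series: in each term the approximants eventually act like \<open>T\<close>.\<close>

lemma trace_functional_tendsto:
  assumes bound: "\<And>i. norm (A i) \<le> K"
    and lim: "\<And>h. eventually (\<lambda>i. blinfun_apply (A i) h = blinfun_apply T h) F"
    and F: "F \<noteq> bot"
  shows "((\<lambda>i. trace_functional x y (A i)) \<longlongrightarrow> trace_functional x y T) F"
proof -
  have "((\<lambda>i. \<Sum>n. cinner (blinfun_apply (A i) (x n)) (y n)) \<longlongrightarrow>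
      (\<Sum>n. cinner (blinfun_apply T (x n)) (y n))) F"
  proof (rule tannerys_theorem[THEN conjunct2, THEN conjunct2])
    show "((\<lambda>i. cinner (blinfun_apply (A i) (x n)) (y n)) \<longlongrightarrow>
        cinner (blinfun_apply T (x n)) (y n)) F" for n
      using lim[of "x n"] by (intro tendsto_eventually) (auto elim: eventually_mono)
    show "\<forall>\<^sub>F (n, i) in sequentially \<times>\<^sub>F F.
        norm (cinner (blinfun_apply (A i) (x n)) (y n)) \<le> K * ((norm (x n))\<^sup>2 + (norm (y n))\<^sup>2)"
    proof (intro always_eventually allI, clarify)
      fix n i
      have "norm (cinner (blinfun_apply (A i) (x n)) (y n))
          \<le> norm (A i) * ((norm (x n))\<^sup>2 + (norm (y n))\<^sup>2)" by (rule trace_term_le)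
      also have "\<dots> \<le> K * ((norm (x n))\<^sup>2 + (norm (y n))\<^sup>2)"
        by (intro mult_right_mono bound) simp
      finally show "norm (cinner (blinfun_apply (A i) (x n)) (y n))
          \<le> K * ((norm (x n))\<^sup>2 + (norm (y n))\<^sup>2)" .
    qed
  qed (use F trace_bound_summable in auto)
  then show ?thesis by (simp only: trace_functional_def)
qed

lemma trace_functional_AC:
  "restrict_functional bounded_ops (trace_functional x y) \<in> AC bounded_ops"
proof -
  let ?f = "trace_functional x y" and ?r = "restrict_functional bounded_ops (trace_functional x y)"
  have pre: "?f \<in> predual" unfolding predual_def using x y by blast
  have lin: "linear_functional bounded_ops ?r"
    by (simp add: linear_functional_def restrict_functional_def bounded_ops_closed
        trace_functional_add trace_functional_scaleC)
  have "continuous_map weak_star_topology euclidean ?r"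
  proof (subst continuous_map, intro conjI allI impI)
    fix U :: "complex set" assume "openin euclidean U"
    then have "{T \<in> bounded_ops. ?f T \<in> U} \<in>
        {{T \<in> bounded_ops. f T \<in> U} | f U. f \<in> predual \<and> open U}" using pre by auto
    then have "openin weak_star_topology {T \<in> bounded_ops. ?f T \<in> U}"
      unfolding weak_star_topology_def by (rule topology_generated_by_Basis)
    moreover have "{T \<in> topspace weak_star_topology. ?r T \<in> U} = {T \<in> bounded_ops. ?f T \<in> U}"
      by (auto simp: topspace_weak_star_topology restrict_functional_def)
    ultimately show "openin weak_star_topology {T \<in> topspace weak_star_topology. ?r T \<in> U}" by simp
  qed simp
  moreover have "restrict_functional bounded_ops ?r = ?r" by (auto simp: restrict_functional_def)
  moreover have "\<exists>K. \<forall>T\<in>bounded_ops. cmod (?r T) \<le> K * norm T"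
    using trace_functional_bound by (auto simp: restrict_functional_def)
  ultimately show ?thesis using lin by (auto simp: AC_def dual_def)
qed

end

text \<open>An orthonormal set whose span contains a finite \<open>F\<close>.  It is orthonormal for infinite \<open>F\<close> too, so
  that bounds on the projections hold for every index of the net and not just eventually.\<close>

definition hull_basis :: "'h::complex_hilbert_space set \<Rightarrow> 'h set" where
  "hull_basis F =
     (SOME E. orthonormal E \<and> (finite F \<longrightarrow> (\<forall>x\<in>F. blinfun_apply (proj E) x = x)))"

lemma hull_basis:
  shows "orthonormal (hull_basis F)"
    and "finite F \<Longrightarrow> x \<in> F \<Longrightarrow> blinfun_apply (proj (hull_basis F)) x = x"
proof -
  have "\<exists>E. orthonormal E \<and> (finite F \<longrightarrow> (\<forall>x\<in>F. blinfun_apply (proj E) x = x))"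
    using proj_fixing_finite_set[of F] by (cases "finite F") (auto simp: orthonormal_def)
  from someI_ex[OF this]
  show "orthonormal (hull_basis F)"
    and "finite F \<Longrightarrow> x \<in> F \<Longrightarrow> blinfun_apply (proj (hull_basis F)) x = x"
    by (auto simp: hull_basis_def)
qed

lemma eventually_proj_hull_basis:
  "\<forall>\<^sub>F F in finite_subsets_at_top UNIV. blinfun_apply (proj (hull_basis F)) x = x"
  unfolding eventually_finite_subsets_at_top
  by (intro exI[of _ "{x}"]) (auto simp: hull_basis(2))

text \<open>The block-diagonal operator with blocks \<open>P S P\<close> and \<open>(1 - P) T (1 - P)\<close>.\<close>

definition pinch ::
  "'h::complex_hilbert_space set \<Rightarrow> ('h \<Rightarrow>\<^sub>L 'h) \<Rightarrow> ('h \<Rightarrow>\<^sub>L 'h) \<Rightarrow> ('h \<Rightarrow>\<^sub>L 'h)" where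
  "pinch E S T = (proj E o\<^sub>L (S o\<^sub>L proj E)) +
     ((id_blinfun - proj E) o\<^sub>L (T o\<^sub>L (id_blinfun - proj E)))"

lemma pinch_apply:
  "blinfun_apply (pinch E S T) h = blinfun_apply (proj E) (blinfun_apply S (blinfun_apply (proj E) h))
    + (blinfun_apply T (h - blinfun_apply (proj E) h)
      - blinfun_apply (proj E) (blinfun_apply T (h - blinfun_apply (proj E) h)))"
  by (simp add: pinch_def blinfun.add_left blinfun.diff_left)

lemma pinch_bounded_ops:
  assumes "S \<in> bounded_ops" "T \<in> bounded_ops"
  shows "pinch E S T \<in> bounded_ops"
  unfolding bounded_ops_def
  by (simp add: pinch_apply bounded_opsD[OF assms(1)] bounded_opsD[OF assms(2)]
      bounded_opsD[OF proj_bounded_ops] scaleC_add_right flip: scaleC_diff_right)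

lemma norm_pinch_le:
  assumes E: "orthonormal E" and S: "norm S \<le> 1" and T: "norm T \<le> 1"
  shows "norm (pinch E S T) \<le> 1"
proof (rule norm_blinfun_bound)
  fix h
  let ?P = "blinfun_apply (proj E)"
  let ?a = "?P h" and ?b = "h - ?P h"
  have contr: "norm (blinfun_apply A v) \<le> norm v" if "norm A \<le> 1" for A :: "'a \<Rightarrow>\<^sub>L 'a" and v
  proof -
    have "norm (blinfun_apply A v) \<le> norm A * norm v" by (rule norm_blinfun)
    also have "\<dots> \<le> 1 * norm v" using that by (intro mult_right_mono) auto
    finally show ?thesis by simp
  qed
  have "(norm (blinfun_apply (pinch E S T) h))\<^sup>2 = (norm (?P (blinfun_apply S ?a)))\<^sup>2
      + (norm (blinfun_apply T ?b - ?P (blinfun_apply T ?b)))\<^sup>2"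
    unfolding pinch_apply by (rule pythagoras[OF proj_orth[OF E]])
  also have "\<dots> \<le> (norm ?a)\<^sup>2 + (norm ?b)\<^sup>2"
    by (intro add_mono power_mono order_trans[OF norm_proj_apply_le(1)[OF E] contr[OF S]]
        order_trans[OF norm_proj_apply_le(2)[OF E] contr[OF T]]) auto
  also have "\<dots> = (norm h)\<^sup>2" using proj_pythagoras[OF E, of h] by simp
  finally show "norm (blinfun_apply (pinch E S T) h) \<le> 1 * norm h"
    using power2_le_imp_le by fastforce
qed simp

lemma eventually_pinch:
  "\<forall>\<^sub>F F in finite_subsets_at_top UNIV. blinfun_apply (pinch (hull_basis F) S T) h = blinfun_apply S h"
proof -
  have "\<forall>\<^sub>F F in finite_subsets_at_top UNIV. blinfun_apply (proj (hull_basis F)) h = h \<and>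
      blinfun_apply (proj (hull_basis F)) (blinfun_apply S h) = blinfun_apply S h"
    by (intro eventually_conj eventually_proj_hull_basis)
  then show ?thesis by (rule eventually_mono) (simp add: pinch_apply)
qed

text \<open>All blocks of the difference except the vanishing corner \<open>(1 - P) \<cdot> (1 - P)\<close> have finite rank.\<close>

lemma pinch_diff_compact:
  assumes S: "S \<in> bounded_ops" and T: "T \<in> bounded_ops"
  shows "pinch E S T - T \<in> compact_ops"
proof -
  let ?P = "proj E"
  have c: "?P o\<^sub>L A \<in> compact_ops" "A o\<^sub>L ?P \<in> compact_ops" if "A \<in> bounded_ops" for A
    by (rule compact_ops_compose_right[OF that proj_compact],
        rule compact_ops_compose_left[OF that proj_compact])
  have d: "?P o\<^sub>L (A o\<^sub>L ?P) \<in> compact_ops" if "A \<in> bounded_ops" for A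
    by (rule compact_ops_compose_left[OF proj_bounded_ops c(2)[OF that]])
  have "pinch E S T - T = ((?P o\<^sub>L (S o\<^sub>L ?P)) + (?P o\<^sub>L (T o\<^sub>L ?P))) - (T o\<^sub>L ?P) - (?P o\<^sub>L T)"
    by (rule blinfun_eqI) (simp add: pinch_apply blinfun.add_left blinfun.diff_left blinfun.diff_right)
  moreover have "(?P o\<^sub>L (S o\<^sub>L ?P)) + (?P o\<^sub>L (T o\<^sub>L ?P)) \<in> compact_ops"
    using d[OF S] d[OF T] op_subspace_compact_ops unfolding op_subspace_def by blast
  ultimately show ?thesis
    using c[OF T] by (simp only:) (intro op_subspace_diff[OF op_subspace_compact_ops])
qed

section \<open>Splitting functionals on B(H)\<close>

text \<open>\<open>T\<close> is the norm limit of operators \<open>P T\<close> with \<open>P\<close> a finite-rank projection, and \<open>P T\<close> is a sum of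
  rank-one operators by the Riesz representation of \<open>h \<mapsto> \<langle>T h, e\<rangle>\<close>.\<close>

lemma vanishes_on_compact_ops:
  assumes \<sigma>: "\<sigma> \<in> dual bounded_ops" and zero: "\<And>x y. \<sigma> (rank_one x y) = 0"
    and T: "T \<in> compact_ops"
  shows "\<sigma> T = 0"
proof -
  let ?K = "dual_norm bounded_ops \<sigma>"
  have TB: "T \<in> bounded_ops" using T by (rule compact_ops_bounded)
  have lin: "linear_functional bounded_ops \<sigma>" using \<sigma> by (simp add: dual_def)
  have K: "0 \<le> ?K" by (rule dual_norm_nonneg[OF op_subspace_bounded_ops \<sigma>])
  have finite_rank: "\<sigma> (proj E o\<^sub>L T) = 0" for E
  proof -
    have "\<exists>w. \<forall>h. cinner (blinfun_apply T h) e = cinner h w" for e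
    proof (rule Riesz_representation)
      fix h
      have "cmod (cinner (blinfun_apply T h) e) \<le> norm (blinfun_apply T h) * norm e"
        by (rule cinner_Cauchy_Schwarz)
      also have "\<dots> \<le> (norm T * norm h) * norm e" by (intro mult_right_mono norm_blinfun) auto
      finally show "cmod (cinner (blinfun_apply T h) e) \<le> (norm T * norm e) * norm h"
        by (simp only: mult_ac)
    qed (simp_all add: blinfun.add_right cinner_simps bounded_opsD[OF TB])
    then obtain w where w: "\<And>h e. cinner (blinfun_apply T h) e = cinner h (w e)" by metis
    have "proj E o\<^sub>L T = (\<Sum>e\<in>E. rank_one e (w e))"
      by (rule blinfun_eqI) (simp add: proj_apply blinfun.sum_left w)
    then show ?thesis
      by (simp add: linear_functional_sum[OF op_subspace_bounded_ops lin] rank_one_bounded_ops zero)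
  qed
  have "cmod (\<sigma> T) \<le> ?K * e" if e: "e > 0" for e
  proof -
    obtain E where E: "orthonormal E" "norm (T - (proj E o\<^sub>L T)) \<le> e"
      using compact_op_approx_proj[OF T e] by blast
    have PT: "proj E o\<^sub>L T \<in> bounded_ops" by (rule bounded_ops_compose[OF proj_bounded_ops TB])
    have "\<sigma> T = \<sigma> (T - (proj E o\<^sub>L T))"
      using linear_functional_diff[OF op_subspace_bounded_ops lin TB PT] finite_rank by simp
    also have "cmod \<dots> \<le> ?K * norm (T - (proj E o\<^sub>L T))"
      by (rule dual_norm_bound[OF op_subspace_bounded_ops \<sigma>])
        (rule op_subspace_diff[OF op_subspace_bounded_ops TB PT])
    also have "\<dots> \<le> ?K * e" using E(2) K by (rule mult_left_mono)
    finally show ?thesis .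
  qed
  from this[of "inverse (real (Suc _))"] have "cmod (\<sigma> T) \<le> ?K * inverse (real (Suc n))" for n
    by simp
  moreover have "(\<lambda>n. ?K * inverse (real (Suc n))) \<longlonglongrightarrow> ?K * 0"
    by (intro tendsto_mult tendsto_const LIMSEQ_inverse_real_of_nat)
  ultimately have "cmod (\<sigma> T) \<le> ?K * 0" by (intro LIMSEQ_le_const) auto
  then show ?thesis by simp
qed

text \<open>For contractions \<open>S\<close>, \<open>T\<close>, rotated so that \<open>\<alpha> S\<close> and \<open>\<sigma> T\<close> are nonnegative, evaluate \<open>\<psi>\<close> at the
  contractions \<open>pinch E S T\<close>: there \<open>\<sigma>\<close> always takes the value \<open>\<sigma> T\<close>, and \<open>\<alpha>\<close> tends to \<open>\<alpha> S\<close> as \<open>E\<close>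
  grows.  Hence \<open>\<bar>\<alpha> S\<bar> + \<bar>\<sigma> T\<bar> \<le> \<parallel>\<psi>\<parallel>\<close>.\<close>

theorem functional_split:
  fixes \<psi> :: "'h::complex_hilbert_space op_functional"
  assumes \<psi>: "\<psi> \<in> dual bounded_ops"
  shows "\<exists>\<alpha>\<in>AC bounded_ops. (\<forall>T\<in>compact_ops. \<psi> T = \<alpha> T) \<and>
    dual_norm bounded_ops \<alpha> + dual_norm bounded_ops (\<lambda>T. \<psi> T - \<alpha> T) \<le> dual_norm bounded_ops \<psi>"
proof -
  let ?B = "bounded_ops :: ('h \<Rightarrow>\<^sub>L 'h) set" and ?D = "dual_norm bounded_ops \<psi>"
  obtain x y where x: "summable (\<lambda>n. (norm (x n))\<^sup>2)" and y: "summable (\<lambda>n. (norm (y n))\<^sup>2)"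
    and xy: "\<And>u v. \<psi> (rank_one u v) = trace_functional x y (rank_one u v)"
    using functional_trace_on_rank_one[OF \<psi>] by blast
  define \<alpha> where "\<alpha> = restrict_functional ?B (trace_functional x y)"
  define \<sigma> where "\<sigma> T = \<psi> T - \<alpha> T" for T
  have AC: "\<alpha> \<in> AC ?B" unfolding \<alpha>_def by (rule trace_functional_AC[OF x y])
  then have \<alpha>: "\<alpha> \<in> dual ?B" by (simp add: AC_def)
  have \<sigma>: "\<sigma> \<in> dual ?B" unfolding \<sigma>_def by (rule dual_diff[OF op_subspace_bounded_ops \<psi> \<alpha>])
  have lin: "linear_functional ?B \<alpha>" "linear_functional ?B \<sigma>" using \<alpha> \<sigma> by (auto simp: dual_def)
  have sing: "\<sigma> T = 0" if "T \<in> compact_ops" for T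
    by (rule vanishes_on_compact_ops[OF \<sigma> _ that])
      (simp add: \<sigma>_def \<alpha>_def restrict_functional_def rank_one_bounded_ops xy)
  have Bs: "op_scaleC c T \<in> ?B" if "T \<in> ?B" for c T
    using op_subspace_bounded_ops that by (auto simp: op_subspace_def)
  have pair: "cmod (\<alpha> S) + cmod (\<sigma> T) \<le> ?D"
    if S: "S \<in> ?B" "norm S \<le> 1" and T: "T \<in> ?B" "norm T \<le> 1" for S T
  proof -
    obtain c where c: "cmod c = 1" "c * \<alpha> S = complex_of_real (cmod (\<alpha> S))" using phase_exists by blast
    obtain d where d: "cmod d = 1" "d * \<sigma> T = complex_of_real (cmod (\<sigma> T))" using phase_exists by blast
    define S' where "S' = op_scaleC c S"
    define T' where "T' = op_scaleC d T"
    have S': "S' \<in> ?B" "norm S' \<le> 1" "\<alpha> S' = complex_of_real (cmod (\<alpha> S))"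
      using S c Bs lin(1) by (auto simp: S'_def norm_op_scaleC linear_functional_def)
    have T': "T' \<in> ?B" "norm T' \<le> 1" "\<sigma> T' = complex_of_real (cmod (\<sigma> T))"
      using T d Bs lin(2) by (auto simp: T'_def norm_op_scaleC linear_functional_def)
    let ?A = "\<lambda>F. pinch (hull_basis F) S' T'"
    let ?\<F> = "finite_subsets_at_top (UNIV :: 'h set)"
    have AB: "?A F \<in> ?B" for F by (rule pinch_bounded_ops[OF S'(1) T'(1)])
    have An: "norm (?A F) \<le> 1" for F by (rule norm_pinch_le[OF hull_basis(1) S'(2) T'(2)])
    have "((\<lambda>F. trace_functional x y (?A F)) \<longlongrightarrow> trace_functional x y S') ?\<F>"
      by (rule trace_functional_tendsto[OF x y An eventually_pinch]) simp
    then have "((\<lambda>F. \<alpha> (?A F)) \<longlongrightarrow> \<alpha> S') ?\<F>"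
      by (simp add: \<alpha>_def restrict_functional_def AB S'(1))
    moreover have "\<sigma> (?A F) = \<sigma> T'" for F
      using linear_functional_diff[OF op_subspace_bounded_ops lin(2) AB T'(1)]
        sing[OF pinch_diff_compact[OF S'(1) T'(1)]] by simp
    then have "\<psi> (?A F) = \<alpha> (?A F) + \<sigma> T'" for F by (simp add: \<sigma>_def algebra_simps)
    ultimately have "((\<lambda>F. \<psi> (?A F)) \<longlongrightarrow> \<alpha> S' + \<sigma> T') ?\<F>"
      by (simp add: tendsto_add)
    then have lim: "((\<lambda>F. cmod (\<psi> (?A F))) \<longlongrightarrow> cmod (\<alpha> S' + \<sigma> T')) ?\<F>" by (rule tendsto_norm)
    have le: "cmod (\<psi> (?A F)) \<le> ?D" for F
    proof -
      have "cmod (\<psi> (?A F)) \<le> ?D * norm (?A F)" by (rule dual_norm_bound[OF op_subspace_bounded_ops \<psi> AB])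
      also have "\<dots> \<le> ?D" using An dual_norm_nonneg[OF op_subspace_bounded_ops \<psi>] by (rule mult_left_le)
      finally show ?thesis .
    qed
    have "cmod (\<alpha> S' + \<sigma> T') \<le> ?D"
      by (rule tendsto_upperbound[OF lim always_eventually[OF allI[OF le]]]) simp
    moreover have "cmod (\<alpha> S' + \<sigma> T') = cmod (\<alpha> S) + cmod (\<sigma> T)"
      unfolding S'(3) T'(3) of_real_add[symmetric] norm_of_real by simp
    ultimately show ?thesis by simp
  qed
  have "dual_norm ?B \<alpha> \<le> ?D - cmod (\<sigma> T)" if "T \<in> ?B" "norm T \<le> 1" for T
  proof (rule dual_norm_least[OF op_subspace_bounded_ops])
    show "cmod (\<alpha> S) \<le> ?D - cmod (\<sigma> T)" if "S \<in> ?B" "norm S \<le> 1" for S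
      using pair[OF that \<open>T \<in> ?B\<close> \<open>norm T \<le> 1\<close>] by linarith
  qed
  then have "cmod (\<sigma> T) \<le> ?D - dual_norm ?B \<alpha>" if "T \<in> ?B" "norm T \<le> 1" for T
    using that by fastforce
  then have "dual_norm ?B \<sigma> \<le> ?D - dual_norm ?B \<alpha>"
    by (rule dual_norm_least[OF op_subspace_bounded_ops])
  then have "dual_norm ?B \<alpha> + dual_norm ?B (\<lambda>T. \<psi> T - \<alpha> T) \<le> ?D"
    unfolding \<sigma>_def by simp
  moreover have "\<forall>T\<in>compact_ops. \<psi> T = \<alpha> T" using sing by (auto simp: \<sigma>_def)
  ultimately show ?thesis using AC by blast
qed

text \<open>The finite-rank compressions \<open>P T P\<close> converge to \<open>T\<close> weak-*.  In a topology given by a subbasis,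
  being eventually in every neighbourhood can be checked on the subbasic sets.\<close>

lemma compact_ops_weak_star_dense:
  "(bounded_ops :: ('h::complex_hilbert_space \<Rightarrow>\<^sub>L 'h) set)
    \<subseteq> weak_star_topology closure_of compact_ops"
proof
  fix T :: "'h \<Rightarrow>\<^sub>L 'h" assume T: "T \<in> bounded_ops"
  have zero: "(0 :: 'h \<Rightarrow>\<^sub>L 'h) \<in> bounded_ops" by (rule bounded_ops_closed)
  let ?A = "\<lambda>F. pinch (hull_basis F) T 0"
  let ?\<F> = "finite_subsets_at_top (UNIV :: 'h set)"
  have Ac: "?A F \<in> compact_ops" for F using pinch_diff_compact[OF T zero, of "hull_basis F"] by simp
  have An: "norm (?A F) \<le> norm T" for F
  proof (rule norm_blinfun_bound)
    fix h
    let ?P = "blinfun_apply (proj (hull_basis F))"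
    have "norm (?P (blinfun_apply T (?P h))) \<le> norm (blinfun_apply T (?P h))"
      by (rule norm_proj_apply_le(1)[OF hull_basis(1)])
    also have "\<dots> \<le> norm T * norm (?P h)" by (rule norm_blinfun)
    also have "\<dots> \<le> norm T * norm h"
      by (intro mult_left_mono norm_proj_apply_le(1)[OF hull_basis(1)]) simp
    finally show "norm (blinfun_apply (?A F) h) \<le> norm T * norm h" by (simp add: pinch_apply)
  qed simp
  have ev: "\<forall>\<^sub>F F in ?\<F>. ?A F \<in> U" if "openin weak_star_topology U" "T \<in> U" for U
  proof -
    have "generate_topology_on {{T \<in> bounded_ops. f T \<in> U} | f U. f \<in> predual \<and> open U} U"
      using that(1) unfolding weak_star_topology_def by (rule openin_topology_generated_by)
    then show ?thesis using that(2)
    proof (induction rule: generate_topology_on.induct)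
      case (Int a b)
      then show ?case by (auto intro: eventually_conj)
    next
      case (UN K)
      then obtain k where "k \<in> K" "T \<in> k" by auto
      then have "\<forall>\<^sub>F F in ?\<F>. ?A F \<in> k" using UN by blast
      then show ?case by (rule eventually_mono) (use \<open>k \<in> K\<close> in blast)
    next
      case (Basis s)
      then obtain f V where s: "s = {T \<in> bounded_ops. f T \<in> V}" and f: "f \<in> predual" and V: "open V"
        by blast
      obtain x y where f_eq: "f = trace_functional x y"
        and x: "summable (\<lambda>n. (norm (x n))\<^sup>2)" and y: "summable (\<lambda>n. (norm (y n))\<^sup>2)"
        using f unfolding predual_def by blast
      have "((\<lambda>F. f (?A F)) \<longlongrightarrow> f T) ?\<F>"
        unfolding f_eq by (rule trace_functional_tendsto[OF x y An eventually_pinch]) simp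
      then have "\<forall>\<^sub>F F in ?\<F>. f (?A F) \<in> V"
        using V Basis.prems s by (auto dest: topological_tendstoD)
      then show ?case
        by (rule eventually_mono) (use compact_ops_bounded[OF Ac] s in auto)
    qed simp
  qed
  have "\<exists>R. R \<in> compact_ops \<and> R \<in> U" if "T \<in> U" "openin weak_star_topology U" for U
  proof -
    have "\<exists>F. ?A F \<in> U" using eventually_happens[OF ev[OF that(2,1)]] by simp
    then show ?thesis using Ac by blast
  qed
  then show "T \<in> weak_star_topology closure_of compact_ops"
    unfolding in_closure_of topspace_weak_star_topology using T by blast
qed

section \<open>Functionals on spaces in which the compact operators are weak-* dense\<close>

lemma AC_dual: "\<alpha> \<in> AC X \<Longrightarrow> \<alpha> \<in> dual X"
  by (simp add: AC_def)

lemma dual_lincomb: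
  assumes "op_subspace X" "\<phi> \<in> dual X" "\<psi> \<in> dual X"
  shows "(\<lambda>T. a * \<phi> T + b * \<psi> T) \<in> dual X"
proof -
  obtain K M where K: "\<forall>T\<in>X. cmod (\<phi> T) \<le> K * norm T" and M: "\<forall>T\<in>X. cmod (\<psi> T) \<le> M * norm T"
    using assms by (auto simp: dual_def)
  have "cmod (a * \<phi> T + b * \<psi> T) \<le> (cmod a * K + cmod b * M) * norm T" if "T \<in> X" for T
  proof -
    have "cmod (a * \<phi> T + b * \<psi> T) \<le> cmod a * cmod (\<phi> T) + cmod b * cmod (\<psi> T)"
      using norm_triangle_ineq[of "a * \<phi> T" "b * \<psi> T"] by (simp add: norm_mult)
    also have "\<dots> \<le> cmod a * (K * norm T) + cmod b * (M * norm T)"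
      using K M that by (intro add_mono mult_left_mono) auto
    finally show ?thesis by (simp add: algebra_simps)
  qed
  moreover have "linear_functional X (\<lambda>T. a * \<phi> T + b * \<psi> T)"
    using assms by (simp add: dual_def linear_functional_def algebra_simps)
  ultimately show ?thesis by (auto simp: dual_def)
qed

lemma AC_lincomb:
  assumes X: "op_subspace X" and \<alpha>: "\<alpha> \<in> AC X" and \<beta>: "\<beta> \<in> AC X"
  shows "(\<lambda>T. a * \<alpha> T + b * \<beta> T) \<in> AC X"
proof -
  obtain f where f: "linear_functional bounded_ops f"
    "continuous_map weak_star_topology euclidean f" "restrict_functional X f = \<alpha>"
    using \<alpha> by (auto simp: AC_def)
  obtain g where g: "linear_functional bounded_ops g"
    "continuous_map weak_star_topology euclidean g" "restrict_functional X g = \<beta>"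
    using \<beta> by (auto simp: AC_def)
  let ?h = "\<lambda>T. a * f T + b * g T"
  have mult: "continuous_map weak_star_topology euclidean (\<lambda>T. c * k T)"
    if "continuous_map weak_star_topology euclidean k" for c :: complex and k :: "'a op_functional"
  proof -
    have "continuous_map euclidean euclidean (\<lambda>z. c * z)"
      by (simp add: continuous_on_mult_left)
    from continuous_map_compose[OF that this] show ?thesis by (simp add: o_def)
  qed
  have "linear_functional bounded_ops ?h"
    using f(1) g(1) by (simp add: linear_functional_def algebra_simps)
  moreover have "continuous_map weak_star_topology euclidean ?h"
    by (intro continuous_map_add mult f g)
  moreover have "restrict_functional X ?h = (\<lambda>T. a * \<alpha> T + b * \<beta> T)"
    using f(3) g(3) by (auto simp: restrict_functional_def)
  ultimately show ?thesis
    using dual_lincomb[OF X AC_dual[OF \<alpha>] AC_dual[OF \<beta>]] unfolding AC_def by blast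
qed

lemma dual_restrict:
  assumes X: "op_subspace X" and \<psi>: "\<psi> \<in> dual bounded_ops"
  shows "restrict_functional X \<psi> \<in> dual X"
proof -
  have sub: "X \<subseteq> bounded_ops" using X by (simp add: op_subspace_def)
  obtain K where "\<forall>T\<in>bounded_ops. cmod (\<psi> T) \<le> K * norm T" using \<psi> by (auto simp: dual_def)
  then have "\<forall>T\<in>X. cmod (restrict_functional X \<psi> T) \<le> K * norm T"
    using sub by (auto simp: restrict_functional_def)
  moreover have "linear_functional X (restrict_functional X \<psi>)"
    using \<psi> X subsetD[OF sub]
    by (simp add: dual_def linear_functional_def restrict_functional_def op_subspace_def)
  ultimately show ?thesis by (auto simp: dual_def)
qed

lemma dual_norm_restrict_le:
  assumes X: "op_subspace X" and \<psi>: "\<psi> \<in> dual bounded_ops"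
  shows "dual_norm X (restrict_functional X \<psi>) \<le> dual_norm bounded_ops \<psi>"
proof (rule dual_norm_least[OF X])
  fix T assume T: "T \<in> X" "norm T \<le> 1"
  have "cmod (restrict_functional X \<psi> T) = cmod (\<psi> T)" using T by (simp add: restrict_functional_def)
  also have "\<dots> \<le> dual_norm bounded_ops \<psi> * norm T"
    using T X by (intro dual_norm_bound[OF op_subspace_bounded_ops \<psi>]) (auto simp: op_subspace_def)
  also have "\<dots> \<le> dual_norm bounded_ops \<psi>"
    using T dual_norm_nonneg[OF op_subspace_bounded_ops \<psi>] by (intro mult_left_le) auto
  finally show "cmod (restrict_functional X \<psi> T) \<le> dual_norm bounded_ops \<psi>" .
qed

lemma AC_restrict:
  assumes X: "op_subspace X" and \<alpha>: "\<alpha> \<in> AC bounded_ops"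
  shows "restrict_functional X \<alpha> \<in> AC X"
proof -
  obtain f where f: "linear_functional bounded_ops f"
    "continuous_map weak_star_topology euclidean f" "restrict_functional bounded_ops f = \<alpha>"
    using \<alpha> by (auto simp: AC_def)
  have "restrict_functional X f = restrict_functional X \<alpha>"
    unfolding f(3)[symmetric] using X by (auto simp: restrict_functional_def op_subspace_def fun_eq_iff)
  then show ?thesis using f dual_restrict[OF X AC_dual[OF \<alpha>]] unfolding AC_def by blast
qed

lemma dual_norm_triangle:
  assumes X: "op_subspace X" and \<phi>: "\<phi> \<in> dual X" and \<alpha>: "\<alpha> \<in> dual X"
  shows "dual_norm X \<phi> \<le> dual_norm X \<alpha> + dual_norm X (\<lambda>T. \<phi> T - \<alpha> T)"
proof (rule dual_norm_least[OF X])
  fix T assume T: "T \<in> X" "norm T \<le> 1"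
  have le: "cmod (\<beta> T) \<le> dual_norm X \<beta>" if "\<beta> \<in> dual X" for \<beta>
  proof -
    have "cmod (\<beta> T) \<le> dual_norm X \<beta> * norm T" by (rule dual_norm_bound[OF X that T(1)])
    also have "\<dots> \<le> dual_norm X \<beta>" using T dual_norm_nonneg[OF X that] by (intro mult_left_le) auto
    finally show ?thesis .
  qed
  have "cmod (\<phi> T) \<le> cmod (\<alpha> T) + cmod (\<phi> T - \<alpha> T)" by (rule norm_triangle_sub)
  then show "cmod (\<phi> T) \<le> dual_norm X \<alpha> + dual_norm X (\<lambda>T. \<phi> T - \<alpha> T)"
    using le[OF \<alpha>] le[OF dual_diff[OF X \<phi> \<alpha>]] by linarith
qed

locale compact_dense =
  fixes X :: "('h::complex_hilbert_space \<Rightarrow>\<^sub>L 'h) set"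
  assumes X: "op_subspace X"
    and dense: "X \<subseteq> weak_star_topology closure_of (X \<inter> compact_ops)"
begin

text \<open>The difference extends to a weak-* continuous functional, whose zero set is closed and contains
  \<open>X \<inter> compact_ops\<close>.\<close>

lemma AC_determined:
  assumes \<alpha>: "\<alpha> \<in> AC X" and \<beta>: "\<beta> \<in> AC X"
    and eq: "\<And>T. T \<in> X \<Longrightarrow> T \<in> compact_ops \<Longrightarrow> \<alpha> T = \<beta> T"
  shows "\<alpha> = \<beta>"
proof -
  have "(\<lambda>T. 1 * \<alpha> T + (- 1) * \<beta> T) \<in> AC X" by (rule AC_lincomb[OF X \<alpha> \<beta>])
  then obtain f where f: "continuous_map weak_star_topology euclidean f"
    "restrict_functional X f = (\<lambda>T. \<alpha> T - \<beta> T)"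
    by (auto simp: AC_def)
  have fX: "f T = \<alpha> T - \<beta> T" if "T \<in> X" for T
    using fun_cong[OF f(2), of T] that by (simp add: restrict_functional_def)
  have "closedin weak_star_topology {T \<in> topspace weak_star_topology. f T \<in> {0}}"
    by (rule closedin_continuous_map_preimage[OF f(1)]) simp
  moreover have "X \<inter> compact_ops \<subseteq> {T \<in> topspace weak_star_topology. f T \<in> {0}}"
    using fX eq compact_ops_bounded by (auto simp: topspace_weak_star_topology)
  ultimately have "weak_star_topology closure_of (X \<inter> compact_ops)
      \<subseteq> {T \<in> topspace weak_star_topology. f T \<in> {0}}" by (intro closure_of_minimal)
  then have "f T = 0" if "T \<in> X" for T using dense that by blast
  then have on: "\<alpha> T = \<beta> T" if "T \<in> X" for T using fX that by fastforce
  have off: "\<alpha> T = \<beta> T" if "T \<notin> X" for T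
    using AC_dual[OF \<alpha>] AC_dual[OF \<beta>] that by (simp add: dual_def linear_functional_def)
  show ?thesis using on off by blast
qed

definition ac_part :: "'h op_functional \<Rightarrow> 'h op_functional" where
  "ac_part \<phi> = (SOME \<alpha>. \<alpha> \<in> AC X \<and> (\<forall>T\<in>X \<inter> compact_ops. \<phi> T = \<alpha> T))"

text \<open>Extend to \<open>B(H)\<close> without increasing the norm, split there, restrict back.\<close>

lemma decomposition_exists:
  assumes \<phi>: "\<phi> \<in> dual X"
  shows "\<exists>\<alpha>\<in>AC X. (\<forall>T\<in>X \<inter> compact_ops. \<phi> T = \<alpha> T) \<and>
    dual_norm X \<phi> = dual_norm X \<alpha> + dual_norm X (\<lambda>T. \<phi> T - \<alpha> T)"
proof -
  obtain \<psi> where \<psi>: "\<psi> \<in> dual bounded_ops" "restrict_functional X \<psi> = \<phi>"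
    "dual_norm bounded_ops \<psi> \<le> dual_norm X \<phi>"
    using Hahn_Banach_operators[OF X \<phi>] by blast
  obtain \<alpha> where \<alpha>: "\<alpha> \<in> AC bounded_ops" "\<forall>T\<in>compact_ops. \<psi> T = \<alpha> T"
    "dual_norm bounded_ops \<alpha> + dual_norm bounded_ops (\<lambda>T. \<psi> T - \<alpha> T) \<le> dual_norm bounded_ops \<psi>"
    using functional_split[OF \<psi>(1)] by blast
  let ?\<alpha> = "restrict_functional X \<alpha>"
  have AC: "?\<alpha> \<in> AC X" by (rule AC_restrict[OF X \<alpha>(1)])
  have \<sigma>: "(\<lambda>T. \<psi> T - \<alpha> T) \<in> dual bounded_ops"
    by (rule dual_diff[OF op_subspace_bounded_ops \<psi>(1) AC_dual[OF \<alpha>(1)]])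
  have "restrict_functional X (\<lambda>T. \<psi> T - \<alpha> T) = (\<lambda>T. \<phi> T - ?\<alpha> T)"
    unfolding \<psi>(2)[symmetric] by (auto simp: restrict_functional_def)
  then have "dual_norm X ?\<alpha> + dual_norm X (\<lambda>T. \<phi> T - ?\<alpha> T) \<le> dual_norm X \<phi>"
    using dual_norm_restrict_le[OF X AC_dual[OF \<alpha>(1)]] dual_norm_restrict_le[OF X \<sigma>] \<alpha>(3) \<psi>(3)
    by simp
  then have "dual_norm X \<phi> = dual_norm X ?\<alpha> + dual_norm X (\<lambda>T. \<phi> T - ?\<alpha> T)"
    using dual_norm_triangle[OF X \<phi> AC_dual[OF AC]] by linarith
  moreover have "\<phi> T = ?\<alpha> T" if "T \<in> X \<inter> compact_ops" for T
    unfolding \<psi>(2)[symmetric] using that \<alpha>(2) by (auto simp: restrict_functional_def)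
  ultimately show ?thesis using AC by blast
qed

lemma ac_part:
  assumes "\<phi> \<in> dual X"
  shows "ac_part \<phi> \<in> AC X" and "T \<in> X \<Longrightarrow> T \<in> compact_ops \<Longrightarrow> ac_part \<phi> T = \<phi> T"
proof -
  have "\<exists>\<alpha>. \<alpha> \<in> AC X \<and> (\<forall>T\<in>X \<inter> compact_ops. \<phi> T = \<alpha> T)"
    using decomposition_exists[OF assms] by blast
  from someI_ex[OF this]
  show "ac_part \<phi> \<in> AC X" and "T \<in> X \<Longrightarrow> T \<in> compact_ops \<Longrightarrow> ac_part \<phi> T = \<phi> T"
    by (auto simp: ac_part_def)
qed

lemma ac_part_eqI:
  assumes "\<phi> \<in> dual X" "\<alpha> \<in> AC X" "\<And>T. T \<in> X \<Longrightarrow> T \<in> compact_ops \<Longrightarrow> \<phi> T = \<alpha> T"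
  shows "ac_part \<phi> = \<alpha>"
  by (rule AC_determined) (use assms ac_part[OF assms(1)] in auto)

lemma dual_norm_ac_part:
  assumes \<phi>: "\<phi> \<in> dual X"
  shows "dual_norm X \<phi> = dual_norm X (ac_part \<phi>) + dual_norm X (\<lambda>T. \<phi> T - ac_part \<phi> T)"
proof -
  obtain \<alpha> where \<alpha>: "\<alpha> \<in> AC X" "\<forall>T\<in>X \<inter> compact_ops. \<phi> T = \<alpha> T"
    "dual_norm X \<phi> = dual_norm X \<alpha> + dual_norm X (\<lambda>T. \<phi> T - \<alpha> T)"
    using decomposition_exists[OF \<phi>] by blast
  have "ac_part \<phi> = \<alpha>" using \<alpha> by (intro ac_part_eqI[OF \<phi>]) auto
  then show ?thesis using \<alpha>(3) by simp
qed

lemma ac_part_lincomb: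
  assumes \<phi>: "\<phi> \<in> dual X" and \<psi>: "\<psi> \<in> dual X"
  shows "ac_part (\<lambda>T. a * \<phi> T + b * \<psi> T) = (\<lambda>T. a * ac_part \<phi> T + b * ac_part \<psi> T)"
  by (rule ac_part_eqI[OF dual_lincomb[OF X \<phi> \<psi>] AC_lincomb[OF X ac_part(1)[OF \<phi>] ac_part(1)[OF \<psi>]]])
    (simp add: ac_part(2)[OF \<phi>] ac_part(2)[OF \<psi>])

lemma ac_part_AC: "\<alpha> \<in> AC X \<Longrightarrow> ac_part \<alpha> = \<alpha>"
  by (rule ac_part_eqI) (auto dest: AC_dual)

lemma lebesgue_projection_ac_part: "lebesgue_projection X ac_part"
  unfolding lebesgue_projection_def
proof (intro conjI ballI allI)
  show "ac_part \<phi> \<in> dual X" if "\<phi> \<in> dual X" for \<phi> by (rule AC_dual[OF ac_part(1)[OF that]])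
  show "ac_part (\<lambda>T. \<phi> T + \<psi> T) = (\<lambda>T. ac_part \<phi> T + ac_part \<psi> T)"
    if "\<phi> \<in> dual X" "\<psi> \<in> dual X" for \<phi> \<psi>
    using ac_part_lincomb[OF that, of 1 1] by simp
  show "ac_part (\<lambda>T. c * \<phi> T) = (\<lambda>T. c * ac_part \<phi> T)" if "\<phi> \<in> dual X" for c \<phi>
    using ac_part_lincomb[OF that that, of c 0] by simp
  show "\<exists>K. \<forall>\<phi>\<in>dual X. dual_norm X (ac_part \<phi>) \<le> K * dual_norm X \<phi>"
  proof (intro exI[of _ 1] ballI)
    fix \<phi> assume \<phi>: "\<phi> \<in> dual X"
    have "0 \<le> dual_norm X (\<lambda>T. \<phi> T - ac_part \<phi> T)"
      by (rule dual_norm_nonneg[OF X dual_diff[OF X \<phi> AC_dual[OF ac_part(1)[OF \<phi>]]]])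
    then show "dual_norm X (ac_part \<phi>) \<le> 1 * dual_norm X \<phi>" using dual_norm_ac_part[OF \<phi>] by simp
  qed
  show "ac_part (ac_part \<phi>) = ac_part \<phi>" if "\<phi> \<in> dual X" for \<phi>
    by (rule ac_part_AC[OF ac_part(1)[OF that]])
  show "ac_part ` dual X = AC X"
    using ac_part(1) by (force simp: ac_part_AC intro: rev_image_eqI AC_dual)
  show "dual_norm X \<phi> = dual_norm X (ac_part \<phi>) + dual_norm X (\<lambda>T. \<phi> T - ac_part \<phi> T)"
    if "\<phi> \<in> dual X" for \<phi>
    by (rule dual_norm_ac_part[OF that])
qed

lemma SG_iff: "\<phi> \<in> SG X \<longleftrightarrow> \<phi> \<in> dual X \<and> (\<forall>T\<in>X \<inter> compact_ops. \<phi> T = 0)"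
proof
  assume "\<phi> \<in> SG X"
  then obtain \<psi> where \<psi>: "\<psi> \<in> dual X" "\<phi> = (\<lambda>T. \<psi> T - ac_part \<psi> T)"
    unfolding SG_eq[OF X lebesgue_projection_ac_part] by blast
  then show "\<phi> \<in> dual X \<and> (\<forall>T\<in>X \<inter> compact_ops. \<phi> T = 0)"
    using dual_diff[OF X \<psi>(1) AC_dual[OF ac_part(1)[OF \<psi>(1)]]] ac_part(2)[OF \<psi>(1)] by auto
next
  assume \<phi>: "\<phi> \<in> dual X \<and> (\<forall>T\<in>X \<inter> compact_ops. \<phi> T = 0)"
  have ac: "ac_part \<phi> \<in> AC X" using ac_part(1) \<phi> by blast
  have "(\<lambda>T. 0 * ac_part \<phi> T + 0 * ac_part \<phi> T) \<in> AC X" by (rule AC_lincomb[OF X ac ac])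
  then have "ac_part \<phi> = (\<lambda>T. 0)" using \<phi> by (intro ac_part_eqI) auto
  then show "\<phi> \<in> SG X"
    unfolding SG_eq[OF X lebesgue_projection_ac_part] using \<phi> by (intro image_eqI[of _ _ \<phi>]) auto
qed

end

interpretation all_ops: compact_dense bounded_ops
proof
  show "op_subspace bounded_ops" by (rule op_subspace_bounded_ops)
  show "bounded_ops \<subseteq> weak_star_topology closure_of (bounded_ops \<inter> compact_ops)"
    by (simp add: Int_absorb1 subsetI compact_ops_bounded compact_ops_weak_star_dense)
qed

theorem corollary4p3:
  fixes X :: "('h::complex_hilbert_space \<Rightarrow>\<^sub>L 'h) set"
  assumes "op_subspace X"
    and "X \<subseteq> weak_star_topology closure_of (X \<inter> compact_ops)"
  shows "compatible_lebesgue_decompositions X bounded_ops \<and>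
    gleason_whitney_property X bounded_ops"
proof -
  interpret compact_dense X using assms by unfold_locales
  have sub: "X \<subseteq> bounded_ops" using X by (simp add: op_subspace_def)
  have "restrict_functional X \<sigma> \<in> SG X" if "\<sigma> \<in> SG bounded_ops" for \<sigma>
  proof -
    have "\<sigma> \<in> dual bounded_ops" "\<forall>T\<in>compact_ops. \<sigma> T = 0"
      using that compact_ops_bounded unfolding all_ops.SG_iff by auto
    then show ?thesis
      using dual_restrict[OF X] unfolding SG_iff by (simp add: restrict_functional_def)
  qed
  then have "compatible_lebesgue_decompositions X bounded_ops"
    unfolding compatible_lebesgue_decompositions_def admits_lebesgue_decomposition_def
    using sub lebesgue_projection_ac_part all_ops.lebesgue_projection_ac_part AC_restrict[OF X]
    by blast
  moreover have "gleason_whitney_property X bounded_ops"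
    unfolding gleason_whitney_property_def
  proof (intro ballI impI, elim conjE)
    fix \<phi> \<psi>
    assume \<phi>: "\<phi> \<in> AC X" and \<psi>: "\<psi> \<in> dual bounded_ops"
      and ext: "restrict_functional X \<psi> = \<phi>" and norm_eq: "dual_norm bounded_ops \<psi> = dual_norm X \<phi>"
    let ?\<alpha> = "all_ops.ac_part \<psi>"
    let ?\<sigma> = "\<lambda>T. \<psi> T - ?\<alpha> T"
    have \<alpha>: "?\<alpha> \<in> AC bounded_ops" by (rule all_ops.ac_part(1)[OF \<psi>])
    have \<sigma>: "?\<sigma> \<in> dual bounded_ops"
      by (rule dual_diff[OF op_subspace_bounded_ops \<psi> AC_dual[OF \<alpha>]])
    have "restrict_functional X ?\<alpha> = \<phi>"
    proof (rule AC_determined[OF AC_restrict[OF X \<alpha>] \<phi>])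
      fix T assume "T \<in> X" "T \<in> compact_ops"
      then show "restrict_functional X ?\<alpha> T = \<phi> T"
        unfolding ext[symmetric]
        using all_ops.ac_part(2)[OF \<psi> compact_ops_bounded] by (simp add: restrict_functional_def)
    qed
    then have "dual_norm bounded_ops \<psi> \<le> dual_norm bounded_ops ?\<alpha>"
      using dual_norm_restrict_le[OF X AC_dual[OF \<alpha>]] norm_eq by simp
    then have "dual_norm bounded_ops ?\<sigma> = 0"
      using all_ops.dual_norm_ac_part[OF \<psi>] dual_norm_nonneg[OF op_subspace_bounded_ops \<sigma>] by simp
    then have "?\<sigma> T = 0" for T by (rule dual_norm_eq_0_imp[OF op_subspace_bounded_ops \<sigma>])
    then have "\<psi> = ?\<alpha>" by (auto simp: fun_eq_iff)
    then show "\<psi> \<in> AC bounded_ops" using \<alpha> by simp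
  qed
  ultimately show ?thesis by blast
qed

end
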